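(* Let $k$ be a field, let $a$ and $b$ be positive integers with $a\leq b$, and consider the following data: (1) an integer $n$ with $2\leq n\leq a+1$; (2) a sequence of integers $(a=c_1,b=c_2,c_3,\ldots,c_n)$ such that $c_i+2\leq c_{i+1}$ for $i=2,\ldots,n-1$; (3) a sequence of integers $(0=e_1,e_2,\ldots,e_n)$ such that $c_i+1\leq e_i<c_{i+1}$ for $i=2,\ldots,n-1$, $c_n+1\leq e_n$, and $\sum_{i=2}^n(e_i-c_i)=a$. Then for each system of data satisfying these conditions there exists an ideal $I=(f,g)\subseteq S=k[[x,y]]$ generated by a regular sequence $f,g$ with $v_{\mathfrak n}(f)=a$ and $v_{\mathfrak n}(g)=b$, such that $\nu(I^* )=n$ and the minimal graded free resolution of $I^*$ over $P$ is completely determined by the two sequences as follows: $$0\longrightarrow\bigoplus_{j=2}^nP(-e_j)\longrightarrow P(-c_1)\oplus\bigoplus_{j=2}^nP(-c_j)\longrightarrow I^*\longrightarrow0.$$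
   Context: Here $\mathfrak n=(x,y)$ is the maximal ideal of $S=k[[x,y]]$ and $P=\operatorname{gr}_{\mathfrak n}(S)=\bigoplus_{i\ge0}\mathfrak n^i/\mathfrak n^{i+1}$, which is a standard graded polynomial ring in two variables over $k$. For $0\ne f\in S$, $v_{\mathfrak n}(f)$ is the largest integer $v$ with $f\in\mathfrak n^v$, and the initial form of $f$ is its class in $\mathfrak n^v/\mathfrak n^{v+1}\subset P$ with $v=v_{\mathfrak n}(f)$. The leading ideal $I^*\subseteq P$ is the homogeneous ideal generated by the initial forms of all elements of $I$. $\nu(I^* )$ is the minimal number of generators of $I^*$. *)

theory Defs
  imports
    "HOL-Computational_Algebra.Formal_Power_Series"
    "HOL-Computational_Algebra.Polynomial"
    "HOL-Library.Function_Algebras"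
begin

section \<open>Ideals of a commutative ring\<close>

text \<open>Ideals are the submodules of the ring, seen as a module over itself.\<close>

lemma module_mult: "module ((*) :: 'a::comm_ring_1 \<Rightarrow> 'a \<Rightarrow> 'a)"
  by standard (simp_all add: algebra_simps)

abbreviation ideal_gen :: "'a::comm_ring_1 set \<Rightarrow> 'a set" where
  "ideal_gen \<equiv> module.span (*)"

primrec ideal_power :: "'a::comm_ring_1 set \<Rightarrow> nat \<Rightarrow> 'a set" where
  "ideal_power I 0 = UNIV"
| "ideal_power I (Suc m) = ideal_gen {r * s | r s. r \<in> I \<and> s \<in> ideal_power I m}"

definition min_num_gens :: "'a::comm_ring_1 set \<Rightarrow> nat" where
  "min_num_gens I = (LEAST m. \<exists>G. finite G \<and> card G = m \<and> ideal_gen G = I)"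

definition regular_sequence :: "'a::comm_ring_1 list \<Rightarrow> bool" where
  "regular_sequence fs \<longleftrightarrow>
     (\<forall>i<length fs. \<forall>h. fs ! i * h \<in> ideal_gen (set (take i fs)) \<longrightarrow>
                         h \<in> ideal_gen (set (take i fs))) \<and>
     ideal_gen (set fs) \<noteq> UNIV"

lemma subspace_ideal_power: "module.subspace (*) (ideal_power I m)"
  by (cases m) (simp_all add: module.subspace_UNIV[OF module_mult] module.subspace_span[OF module_mult])

lemmas ideal_power_zero = module.subspace_0[OF module_mult subspace_ideal_power]
lemmas ideal_power_add = module.subspace_add[OF module_mult subspace_ideal_power]
lemmas ideal_power_neg = module.subspace_neg[OF module_mult subspace_ideal_power]
lemmas ideal_power_diff = module.subspace_diff[OF module_mult subspace_ideal_power]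
lemmas ideal_power_scale = module.subspace_scale[OF module_mult subspace_ideal_power]
lemmas ideal_power_sum = module.subspace_sum[OF module_mult subspace_ideal_power]

lemma ideal_power_mult:
  assumes "r \<in> ideal_power I i" "s \<in> ideal_power I j"
  shows "r * s \<in> ideal_power I (i + j)"
  using assms
proof (induction i arbitrary: r)
  case 0
  then show ?case by (simp add: ideal_power_scale)
next
  case (Suc i)
  from Suc.prems(1) have "r \<in> ideal_gen {r * s | r s. r \<in> I \<and> s \<in> ideal_power I i}" by simp
  then show ?case
  proof (induction r rule: module.span_induct_alt[OF module_mult, consumes 1])
    case 1
    then show ?case using ideal_power_zero[of I "Suc i + j"] by simp
  next
    case (2 c z y)
    then obtain p q where z: "z = p * q" "p \<in> I" "q \<in> ideal_power I i" by blast
    have "q * s \<in> ideal_power I (i + j)" using Suc.IH Suc.prems(2) z(3) by blast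
    then have "p * (q * s) \<in> ideal_power I (Suc i + j)"
      using z(2) by (auto intro!: module.span_base[OF module_mult])
    then have "c * (p * (q * s)) + y * s \<in> ideal_power I (Suc i + j)"
      using 2 by (blast intro: ideal_power_add ideal_power_scale)
    then show ?case by (simp add: z algebra_simps)
  qed
qed

lemma ideal_power_Suc_subset: "ideal_power I (Suc m) \<subseteq> ideal_power I m"
proof -
  have "{r * s | r s. r \<in> I \<and> s \<in> ideal_power I m} \<subseteq> ideal_power I m"
    by (auto intro: ideal_power_scale)
  then show ?thesis
    by (simp add: module.span_minimal[OF module_mult _ subspace_ideal_power])
qed


section \<open>The power series ring in two variables and its associated graded ring\<close>

text \<open>The ring \<open>k[[x,y]]\<close> is rendered as \<open>k[[x]][[y]]\<close>.\<close>

type_synonym 'k ps2 = "'k fps fps"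

definition ps_x :: "'k::field ps2" where "ps_x = fps_const fps_X"

definition ps_y :: "'k::field ps2" where "ps_y = fps_X"

definition max_ideal :: "'k::field ps2 set" (\<open>\<nn>\<close>) where
  "\<nn> = ideal_gen {ps_x, ps_y}"

text \<open>Only meaningful for nonzero \<open>f\<close>.\<close>

definition v_n :: "'k::field ps2 \<Rightarrow> nat" where
  "v_n f = (GREATEST v. f \<in> ideal_power \<nn> v)"

lemma one_notin_max_ideal: "1 \<notin> ideal_power (\<nn> :: 'k::field ps2 set) 1"
proof -
  let ?Z = "{h :: 'k ps2. fps_nth (fps_nth h 0) 0 = 0}"
  have sub: "module.subspace (*) ?Z"
    by (rule module.subspaceI[OF module_mult]) auto
  have "\<nn> \<subseteq> ?Z"
    unfolding max_ideal_def
    by (rule module.span_minimal[OF module_mult _ sub]) (auto simp: ps_x_def ps_y_def)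
  then have "{r * s | r s. r \<in> \<nn> \<and> s \<in> ideal_power \<nn> 0} \<subseteq> ?Z"
    by auto
  then have "ideal_power \<nn> 1 \<subseteq> ?Z"
    by (simp add: module.span_minimal[OF module_mult _ sub])
  then show ?thesis by auto
qed

text \<open>
  The associated graded ring, the direct sum over \<open>i\<close> of the quotients \<open>\<nn>\<^sup>i / \<nn>\<^sup>i\<^sup>+\<^sup>1\<close>.
  A finitely supported sequence of representatives (the \<open>i\<close>-th one in \<open>\<nn>\<^sup>i\<close>) is encoded as the
  polynomial over \<open>k[[x,y]]\<close> with these coefficients, so that the product of classes
  is induced by the product of polynomials.
\<close>

definition gr_rel :: "'k::field ps2 poly \<Rightarrow> 'k ps2 poly \<Rightarrow> bool" where
  "gr_rel p q \<longleftrightarrow>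
     (\<forall>i. coeff p i \<in> ideal_power \<nn> i) \<and> (\<forall>i. coeff q i \<in> ideal_power \<nn> i) \<and>
     (\<forall>i. coeff p i - coeff q i \<in> ideal_power \<nn> (Suc i))"

lemma gr_rel_part_equivp: "part_equivp (gr_rel :: 'a::field ps2 poly \<Rightarrow> _)"
proof (rule part_equivpI)
  show "\<exists>p :: 'a ps2 poly. gr_rel p p"
    by (rule exI[of _ 0]) (simp add: gr_rel_def ideal_power_zero del: ideal_power.simps)
  show "symp (gr_rel :: 'a ps2 poly \<Rightarrow> _)"
  proof (rule sympI)
    fix p q :: "'a ps2 poly" assume "gr_rel p q"
    then show "gr_rel q p"
      unfolding gr_rel_def using ideal_power_neg
      by (metis minus_diff_eq)
  qed
  show "transp (gr_rel :: 'a ps2 poly \<Rightarrow> _)"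
  proof (rule transpI)
    fix p q r :: "'a ps2 poly" assume *: "gr_rel p q" "gr_rel q r"
    have "coeff p i - coeff r i \<in> ideal_power \<nn> (Suc i)" for i
    proof -
      have "(coeff p i - coeff q i) + (coeff q i - coeff r i) \<in> ideal_power \<nn> (Suc i)"
        using * unfolding gr_rel_def by (blast intro: ideal_power_add)
      then show ?thesis by simp
    qed
    then show "gr_rel p r" using * by (simp add: gr_rel_def del: ideal_power.simps)
  qed
qed

quotient_type (overloaded) 'k gr = "'k::field ps2 poly" / partial: gr_rel
  by (rule gr_rel_part_equivp)

instantiation gr :: (field) comm_ring_1
begin

lift_definition zero_gr :: "'a gr" is 0
  by (simp add: gr_rel_def ideal_power_zero del: ideal_power.simps)

lift_definition one_gr :: "'a gr" is 1
proof -
  have "coeff (1 :: 'a ps2 poly) i \<in> ideal_power \<nn> i" for i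
    by (cases i) (simp_all add: ideal_power_zero del: ideal_power.simps(2))
  then show "gr_rel (1 :: 'a ps2 poly) 1"
    by (simp add: gr_rel_def ideal_power_zero del: ideal_power.simps)
qed

lift_definition plus_gr :: "'a gr \<Rightarrow> 'a gr \<Rightarrow> 'a gr" is "(+)"
proof -
  fix p p' q q' :: "'a ps2 poly"
  assume "gr_rel p p'" "gr_rel q q'"
  then show "gr_rel (p + q) (p' + q')"
    by (simp add: gr_rel_def add_diff_add ideal_power_add del: ideal_power.simps)
qed

lift_definition uminus_gr :: "'a gr \<Rightarrow> 'a gr" is uminus
proof -
  fix p p' :: "'a ps2 poly"
  assume *: "gr_rel p p'"
  have "- coeff p i + coeff p' i \<in> ideal_power \<nn> (Suc i)" for i
    using * ideal_power_neg[of "coeff p i - coeff p' i" \<nn> "Suc i"]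
    by (simp add: gr_rel_def del: ideal_power.simps)
  with * show "gr_rel (- p) (- p')"
    by (simp add: gr_rel_def ideal_power_neg del: ideal_power.simps)
qed

lift_definition minus_gr :: "'a gr \<Rightarrow> 'a gr \<Rightarrow> 'a gr" is "(-)"
proof -
  fix p p' q q' :: "'a ps2 poly"
  assume *: "gr_rel p p'" "gr_rel q q'"
  have "coeff p i - coeff q i - (coeff p' i - coeff q' i) \<in> ideal_power \<nn> (Suc i)" for i
    using * ideal_power_diff[of "coeff p i - coeff p' i" \<nn> "Suc i" "coeff q i - coeff q' i"]
    by (simp add: gr_rel_def algebra_simps del: ideal_power.simps)
  with * show "gr_rel (p - q) (p' - q')"
    by (simp add: gr_rel_def ideal_power_diff del: ideal_power.simps)
qed

lift_definition times_gr :: "'a gr \<Rightarrow> 'a gr \<Rightarrow> 'a gr" is "(*)"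
proof -
  fix p p' q q' :: "'a ps2 poly"
  assume *: "gr_rel p p'" "gr_rel q q'"
  have prod: "coeff (r * s) i \<in> ideal_power \<nn> (m + i)"
    if "\<And>i. coeff r i \<in> ideal_power \<nn> (m + i)" "\<And>i. coeff s i \<in> ideal_power \<nn> i"
    for r s :: "'a ps2 poly" and m i
    unfolding coeff_mult
  proof (rule ideal_power_sum)
    fix j assume "j \<in> {..i}"
    then show "coeff r j * coeff s (i - j) \<in> ideal_power \<nn> (m + i)"
      using ideal_power_mult[OF that(1)[of j] that(2)[of "i - j"]] by (simp add: add.assoc)
  qed
  have "coeff ((p - p') * q) i + coeff ((q - q') * p') i \<in> ideal_power \<nn> (Suc i)" for i
    using prod[of "p - p'" 1 q i] prod[of "q - q'" 1 p' i] *
    by (intro ideal_power_add) (simp_all add: gr_rel_def del: ideal_power.simps)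
  moreover have "(p - p') * q + (q - q') * p' = p * q - p' * q'"
    by (simp add: algebra_simps)
  ultimately have "coeff (p * q) i - coeff (p' * q') i \<in> ideal_power \<nn> (Suc i)" for i
    by (metis coeff_add coeff_diff)
  then show "gr_rel (p * q) (p' * q')"
    using prod[of p 0 q] prod[of p' 0 q'] * by (simp add: gr_rel_def del: ideal_power.simps)
qed

instance
proof
  fix a b c :: "'a gr"
  note rsp = times_gr.rsp plus_gr.rsp uminus_gr.rsp minus_gr.rsp
  show "a * b * c = a * (b * c)"
    by transfer (use rsp in \<open>simp add: rel_fun_def mult.assoc\<close>)
  show "a * b = b * a"
    by transfer (use rsp in \<open>simp add: rel_fun_def mult.commute\<close>)
  show "1 * a = a"
    by transfer simp
  show "a + b + c = a + (b + c)"
    by transfer (use rsp in \<open>simp add: rel_fun_def add.assoc\<close>)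
  show "a + b = b + a"
    by transfer (use rsp in \<open>simp add: rel_fun_def add.commute\<close>)
  show "0 + a = a"
    by transfer simp
  show "- a + a = 0"
    by transfer (use zero_gr.rsp in simp)
  show "a - b = a + - b"
    by transfer (use rsp in \<open>simp add: rel_fun_def\<close>)
  show "(a + b) * c = a * c + b * c"
    by transfer (use rsp in \<open>simp add: rel_fun_def distrib_right\<close>)
  show "(0 :: 'a gr) \<noteq> 1"
  proof transfer
    show "\<not> gr_rel 0 (1 :: 'a ps2 poly)"
    proof
      assume "gr_rel 0 (1 :: 'a ps2 poly)"
      then have "coeff 0 0 - coeff (1 :: 'a ps2 poly) 0 \<in> ideal_power \<nn> (Suc 0)"
        unfolding gr_rel_def by blast
      then have "- 1 \<in> ideal_power (\<nn> :: 'a ps2 set) 1"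
        by (simp del: ideal_power.simps)
      then have "1 \<in> ideal_power (\<nn> :: 'a ps2 set) 1"
        using ideal_power_neg by fastforce
      then show False using one_notin_max_ideal by blast
    qed
  qed
qed

end

text \<open>The class of \<open>f\<close> in \<open>\<nn>\<^sup>i / \<nn>\<^sup>i\<^sup>+\<^sup>1\<close>; the value \<open>0\<close> for \<open>f\<close> outside \<open>\<nn>\<^sup>i\<close> is a dummy.\<close>

lift_definition gr_class :: "nat \<Rightarrow> 'k::field ps2 \<Rightarrow> 'k gr" is
  "\<lambda>i f. if f \<in> ideal_power \<nn> i then monom f i else 0"
  by (auto simp: gr_rel_def ideal_power_zero simp del: ideal_power.simps)

text \<open>The graded pieces, indexed by integers so that shifts need no side condition.\<close>

definition gr_piece :: "int \<Rightarrow> 'k::field gr set" where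
  "gr_piece d = (if d < 0 then {0} else gr_class (nat d) ` ideal_power \<nn> (nat d))"

definition initial_form :: "'k::field ps2 \<Rightarrow> 'k gr" where
  "initial_form f = gr_class (v_n f) f"

definition leading_ideal :: "'k::field ps2 set \<Rightarrow> 'k gr set" where
  "leading_ideal I = ideal_gen {initial_form f | f. f \<in> I \<and> f \<noteq> 0}"

definition irrelevant_ideal :: "'k::field gr set" where
  "irrelevant_ideal = ideal_gen (\<Union>d\<in>{1..}. gr_piece d)"


section \<open>Graded free modules and minimal graded free resolutions\<close>

text \<open>
  For a finite index set \<open>J\<close> and \<open>d\<close> giving the degrees of the basis elements,
  \<open>free_module J\<close> is the underlying module of \<open>\<Oplus>\<^sub>j\<^sub>\<in>\<^sub>J P(-d j)\<close>, and
  \<open>free_piece J d m\<close> is its homogeneous component of degree \<open>m\<close>, where \<open>P(-d j)\<^sub>m = P\<^bsub>m - d j\<^esub>\<close>.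
\<close>

definition free_module :: "nat set \<Rightarrow> (nat \<Rightarrow> 'k::field gr) set" where
  "free_module J = {u. \<forall>j. j \<notin> J \<longrightarrow> u j = 0}"

definition free_piece :: "nat set \<Rightarrow> (nat \<Rightarrow> int) \<Rightarrow> int \<Rightarrow> (nat \<Rightarrow> 'k::field gr) set" where
  "free_piece J d m = {u \<in> free_module J. \<forall>j\<in>J. u j \<in> gr_piece (m - d j)}"

definition free_scale :: "'k::field gr \<Rightarrow> (nat \<Rightarrow> 'k gr) \<Rightarrow> nat \<Rightarrow> 'k gr" where
  "free_scale r u = (\<lambda>j. r * u j)"

lemma module_free_scale: "module free_scale"
  by standard (auto simp: free_scale_def fun_eq_iff algebra_simps)

definition linear_on ::
  "'u set \<Rightarrow> ('r \<Rightarrow> 'u \<Rightarrow> 'u) \<Rightarrow> ('r \<Rightarrow> 'w \<Rightarrow> 'w) \<Rightarrow> ('u::plus \<Rightarrow> 'w::plus) \<Rightarrow> bool" where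
  "linear_on M s t \<phi> \<longleftrightarrow>
     (\<forall>u\<in>M. \<forall>w\<in>M. \<phi> (u + w) = \<phi> u + \<phi> w) \<and> (\<forall>r. \<forall>u\<in>M. \<phi> (s r u) = t r (\<phi> u))"

text \<open>
  The sequence \<open>0 \<rightarrow> \<Oplus>\<^sub>j\<^sub>\<in>\<^sub>B P(-e j) \<rightarrow> \<Oplus>\<^sub>j\<^sub>\<in>\<^sub>A P(-c j) \<rightarrow> I \<rightarrow> 0\<close> with maps \<open>\<phi>\<close> and \<open>\<epsilon>\<close> is exact, its maps
  are homogeneous of degree \<open>0\<close>, and it is minimal: the image of \<open>\<phi>\<close> lies in the
  irrelevant ideal times the target of \<open>\<phi>\<close>.
\<close>

definition minimal_graded_free_resolution ::
  "nat set \<Rightarrow> (nat \<Rightarrow> int) \<Rightarrow> nat set \<Rightarrow> (nat \<Rightarrow> int) \<Rightarrow> 'k::field gr set \<Rightarrow>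
   ((nat \<Rightarrow> 'k gr) \<Rightarrow> (nat \<Rightarrow> 'k gr)) \<Rightarrow> ((nat \<Rightarrow> 'k gr) \<Rightarrow> 'k gr) \<Rightarrow> bool" where
  "minimal_graded_free_resolution B e A c I \<phi> \<epsilon> \<longleftrightarrow>
     finite A \<and> finite B \<and>
     linear_on (free_module B) free_scale free_scale \<phi> \<and>
     (\<forall>m. \<phi> ` free_piece B e m \<subseteq> free_piece A c m) \<and>
     linear_on (free_module A) free_scale (*) \<epsilon> \<and>
     (\<forall>m. \<epsilon> ` free_piece A c m \<subseteq> gr_piece m) \<and>
     inj_on \<phi> (free_module B) \<and>
     \<phi> ` free_module B = {u \<in> free_module A. \<epsilon> u = 0} \<and>
     \<epsilon> ` free_module A = I \<and>
     \<phi> ` free_module B \<subseteq>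
       module.span free_scale {free_scale r u | r u. r \<in> irrelevant_ideal \<and> u \<in> free_module A}"

end

theory Submission
  imports Defs
begin

text \<open>
  Put \<open>d\<^sub>j = e\<^sub>j - c\<^sub>j\<close>, \<open>p\<^sub>j = d\<^sub>j\<^sub>+\<^sub>1 + \<dots> + d\<^sub>n\<close> and \<open>t\<^sub>j = c\<^sub>j - p\<^sub>j\<close>. The monomials \<open>m\<^sub>j = x\<^bsup>p\<^sub>j\<^esup> y\<^bsup>t\<^sub>j\<^esup>\<close>
  form a staircase from \<open>x\<^sup>a\<close> to a power of \<open>y\<close>; their syzygies are freely generated by the relations
  between neighbours, \<open>x\<^bsup>d\<^sub>j\<^esup> m\<^sub>j = y\<^bsup>s\<^sub>j\<^esup> m\<^sub>j\<^sub>-\<^sub>1\<close> with \<open>s\<^sub>j = t\<^sub>j - t\<^sub>j\<^sub>-\<^sub>1\<close>, which have degree \<open>e\<^sub>j\<close>. So it is enough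
  to find \<open>f, g\<close> with \<open>I\<^sup>* = (m\<^sub>1, \<dots>, m\<^sub>n)\<close>. Run a Euclidean algorithm backwards: \<open>h\<^sub>n\<^sub>+\<^sub>1 = 0\<close>, \<open>h\<^sub>n = 1\<close>,
  \<open>h\<^sub>j\<^sub>-\<^sub>1 = x\<^bsup>d\<^sub>j\<^esup> h\<^sub>j - y\<^bsup>s\<^sub>j\<^sub>+\<^sub>1\<^esup> h\<^sub>j\<^sub>+\<^sub>1\<close>, and put \<open>g\<^sub>j = y\<^bsup>t\<^sub>j\<^esup> h\<^sub>j\<close>, \<open>f = g\<^sub>1\<close>, \<open>g = g\<^sub>2\<close>. The inequality
  \<open>e\<^sub>j < c\<^sub>j\<^sub>+\<^sub>1\<close> says precisely that the second term has the larger order, so that \<open>g\<^sub>j\<close> has initial form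
  \<open>m\<^sub>j\<close>, and the recursion reads \<open>x\<^bsup>d\<^sub>j\<^esup> g\<^sub>j - y\<^bsup>s\<^sub>j\<^esup> g\<^sub>j\<^sub>-\<^sub>1 = g\<^sub>j\<^sub>+\<^sub>1\<close>. Hence all \<open>g\<^sub>j\<close> lie in \<open>I\<close>, and every
  generating syzygy of the \<open>m\<^sub>j\<close> lifts to a relation of the \<open>g\<^sub>j\<close> with a remainder of larger order, so
  the \<open>g\<^sub>j\<close> are a standard basis of \<open>I\<close>.
\<close>

section \<open>Power series in two variables\<close>

text \<open>The coefficient of \<open>x^i y^j\<close>. The indices are swapped because the outer
  variable of \<open>k[[x]][[y]]\<close> is \<open>y\<close>.\<close>

definition cf :: "'k::field ps2 \<Rightarrow> nat \<Rightarrow> nat \<Rightarrow> 'k" where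
  "cf f i j = fps_nth (fps_nth f j) i"

definition of_cf :: "(nat \<Rightarrow> nat \<Rightarrow> 'k) \<Rightarrow> 'k::field ps2" where
  "of_cf F = Abs_fps (\<lambda>j. Abs_fps (\<lambda>i. F i j))"

lemma cf_of_cf [simp]: "cf (of_cf F) i j = F i j"
  by (simp add: cf_def of_cf_def)

lemma cf_eqI: "(\<And>i j. cf f i j = cf g i j) \<Longrightarrow> f = g"
  by (simp add: cf_def fps_eq_iff)

lemma cf_zero [simp]: "cf 0 i j = 0"
  and cf_one: "cf 1 i j = (if i = 0 \<and> j = 0 then 1 else 0)"
  and cf_add [simp]: "cf (f + g) i j = cf f i j + cf g i j"
  and cf_diff [simp]: "cf (f - g) i j = cf f i j - cf g i j"
  and cf_uminus [simp]: "cf (- f) i j = - cf f i j"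
  by (simp_all add: cf_def)

lemma cf_sum: "cf (\<Sum>x\<in>A. f x) i j = (\<Sum>x\<in>A. cf (f x) i j)"
  by (simp add: cf_def fps_sum_nth)

lemma cf_mult: "cf (f * g) i j = (\<Sum>l\<le>j. \<Sum>k\<le>i. cf f k l * cf g (i - k) (j - l))"
  by (simp add: cf_def fps_mult_nth fps_sum_nth atLeast0AtMost)

definition mon :: "nat \<Rightarrow> nat \<Rightarrow> 'k::field ps2" where
  "mon p q = ps_x ^ p * ps_y ^ q"

lemma ps_x_power: "ps_x ^ p = fps_const (fps_X ^ p)"
  by (simp add: ps_x_def fps_const_power)

lemma cf_mon_mult:
  "cf (mon p q * f) i j = (if p \<le> i \<and> q \<le> j then cf f (i - p) (j - q) else 0)"
proof -
  have eq: "mon p q * f = fps_X ^ q * (fps_const (fps_X ^ p) * f)"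
    by (simp add: mon_def ps_x_power ps_y_def mult_ac)
  show ?thesis
    unfolding eq by (auto simp: cf_def fps_X_power_mult_nth)
qed

lemma mon_mult: "mon p q * mon p' q' = mon (p + p') (q + q')"
  by (simp add: mon_def power_add mult_ac)

lemma mon_mult_left: "mon p q * (mon p' q' * f) = mon (p + p') (q + q') * f"
  by (simp flip: mult.assoc add: mon_mult)

lemma mon_zero [simp]: "mon 0 0 = 1"
  by (simp add: mon_def)

lemma cf_mon: "cf (mon p q) i j = (if i = p \<and> j = q then 1 else 0)"
  using cf_mon_mult[of p q 1 i j] by (auto simp: cf_one)

lemma mon_nonzero [simp]: "mon p q \<noteq> 0"
  by (metis cf_mon cf_zero zero_neq_one)

lemma mon_0_dvd_iff: "mon d 0 dvd f \<longleftrightarrow> (\<forall>i<d. \<forall>j. cf f i j = 0)"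
proof
  assume "\<forall>i<d. \<forall>j. cf f i j = 0"
  then have "f = mon d 0 * of_cf (\<lambda>i j. cf f (i + d) j)"
    by (intro cf_eqI) (simp add: cf_mon_mult)
  then show "mon d 0 dvd f" ..
qed (auto simp: cf_mon_mult elim!: dvdE)

section \<open>Degrees of the support\<close>

text \<open>
  Every monomial of \<open>f\<close>, moved up by \<open>c\<close> degrees, has its degree in \<open>Z\<close>. The sets \<open>{w..}\<close>, \<open>{w}\<close> and
  \<open>{..N}\<close> give membership in a power of the maximal ideal, homogeneous elements and polynomials.
\<close>

definition degs_in :: "int set \<Rightarrow> int \<Rightarrow> 'k::field ps2 \<Rightarrow> bool" where
  "degs_in Z c f \<longleftrightarrow> (\<forall>i j. cf f i j \<noteq> 0 \<longrightarrow> int (i + j) + c \<in> Z)"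

lemma degs_in_zero [simp]: "degs_in Z c 0"
  by (simp add: degs_in_def)

lemma degs_in_add: "degs_in Z c f \<Longrightarrow> degs_in Z c g \<Longrightarrow> degs_in Z c (f + g)"
  unfolding degs_in_def by (metis add.right_neutral cf_add)

lemma degs_in_uminus: "degs_in Z c f \<Longrightarrow> degs_in Z c (- f)"
  by (simp add: degs_in_def)

lemma degs_in_diff: "degs_in Z c f \<Longrightarrow> degs_in Z c g \<Longrightarrow> degs_in Z c (f - g)"
  using degs_in_add[OF _ degs_in_uminus] by fastforce

lemma degs_in_sum: "(\<And>x. x \<in> A \<Longrightarrow> degs_in Z c (f x)) \<Longrightarrow> degs_in Z c (\<Sum>x\<in>A. f x)"
  by (induction A rule: infinite_finite_induct) (auto intro: degs_in_add)

lemma degs_in_mono: "degs_in Z c f \<Longrightarrow> Z \<subseteq> Z' \<Longrightarrow> degs_in Z' c f"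
  by (auto simp: degs_in_def)

lemma degs_in_mon_mult: "degs_in Z c (mon p q * f) \<longleftrightarrow> degs_in Z (c + int (p + q)) f"
proof
  assume *: "degs_in Z c (mon p q * f)"
  show "degs_in Z (c + int (p + q)) f"
    unfolding degs_in_def
  proof (intro allI impI)
    fix i j assume "cf f i j \<noteq> 0"
    then have "cf (mon p q * f) (i + p) (j + q) \<noteq> 0"
      by (simp add: cf_mon_mult)
    then have "int (i + p + (j + q)) + c \<in> Z"
      using * unfolding degs_in_def by blast
    then show "int (i + j) + (c + int (p + q)) \<in> Z"
      by (simp add: algebra_simps)
  qed
next
  assume *: "degs_in Z (c + int (p + q)) f"
  show "degs_in Z c (mon p q * f)"
    unfolding degs_in_def
  proof (intro allI impI)
    fix i j assume "cf (mon p q * f) i j \<noteq> 0"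
    then have "p \<le> i" "q \<le> j" "cf f (i - p) (j - q) \<noteq> 0"
      by (auto simp: cf_mon_mult split: if_splits)
    then have "int (i - p + (j - q)) + (c + int (p + q)) \<in> Z"
      using * unfolding degs_in_def by blast
    then show "int (i + j) + c \<in> Z"
      using \<open>p \<le> i\<close> \<open>q \<le> j\<close> by (simp add: of_nat_diff add.assoc)
  qed
qed

lemma degs_in_mon: "int (p + q) + c \<in> Z \<Longrightarrow> degs_in Z c (mon p q)"
  by (auto simp: degs_in_def cf_mon)

lemma degs_in_mult:
  assumes "degs_in {v..} 0 f" "degs_in {w..} c g"
  shows "degs_in {v + w..} c (f * g)"
  unfolding degs_in_def
proof (intro allI impI)
  fix i j assume "cf (f * g) i j \<noteq> 0"
  then obtain k l where kl: "l \<le> j" "k \<le> i" "cf f k l * cf g (i - k) (j - l) \<noteq> 0"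
    unfolding cf_mult by (metis (no_types, lifting) atMost_iff sum.not_neutral_contains_not_neutral)
  then have "int (k + l) + 0 \<in> {v..}" "int (i - k + (j - l)) + c \<in> {w..}"
    using assms unfolding degs_in_def by (metis mult_zero_left mult_zero_right)+
  then show "int (i + j) + c \<in> {v + w..}"
    using kl(1,2) by (simp add: of_nat_diff)
qed

lemma degs_in_atLeast_shift: "degs_in {w..} c f \<longleftrightarrow> degs_in {w - c..} 0 f"
  by (auto simp: degs_in_def algebra_simps)

lemma degs_in_single_shift: "degs_in {w - c} 0 f \<longleftrightarrow> degs_in {w} c f"
  by (auto simp: degs_in_def algebra_simps)

lemma degs_in_disjoint: "degs_in Z c f \<Longrightarrow> degs_in Z' c f \<Longrightarrow> Z \<inter> Z' = {} \<Longrightarrow> f = 0"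
  unfolding degs_in_def by (intro cf_eqI) (metis cf_zero disjoint_iff)

text \<open>Orders add under multiplication, which gives one inclusion. For the other, a series
  without constant term is split as \<open>x f1 + y f2\<close> with both parts of order one
  less.\<close>

lemma ideal_power_max_ideal: "ideal_power \<nn> m = {f :: 'k::field ps2. degs_in {int m..} 0 f}"
proof (induction m)
  case 0
  show ?case by (auto simp: degs_in_def)
next
  case (Suc m)
  have sub: "module.subspace (*) {f :: 'k ps2. degs_in {v..} 0 f}" for v :: int
  proof (rule module.subspaceI[OF module_mult])
    fix r f :: "'k ps2" assume "f \<in> {f. degs_in {v..} 0 f}"
    moreover have "degs_in {0..} 0 r" by (simp add: degs_in_def)
    ultimately show "r * f \<in> {f. degs_in {v..} 0 f}"
      using degs_in_mult by fastforce
  qed (auto intro: degs_in_add)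
  have "\<nn> \<subseteq> {f :: 'k ps2. degs_in {1..} 0 f}"
    unfolding max_ideal_def
  proof (rule module.span_minimal[OF module_mult _ sub])
    have "degs_in {1..} 0 (mon 1 0 :: 'k ps2)" "degs_in {1..} 0 (mon 0 1 :: 'k ps2)"
      by (auto intro: degs_in_mon)
    then show "{ps_x, ps_y} \<subseteq> {f :: 'k ps2. degs_in {1..} 0 f}"
      by (simp add: mon_def)
  qed
  then have "{r * s | r s. r \<in> \<nn> \<and> s \<in> ideal_power \<nn> m} \<subseteq> {f :: 'k ps2. degs_in {int (Suc m)..} 0 f}"
    using degs_in_mult[of 1 _ "int m" 0] Suc.IH by auto
  then have "ideal_power \<nn> (Suc m) \<subseteq> {f :: 'k ps2. degs_in {int (Suc m)..} 0 f}"
    unfolding ideal_power.simps by (rule module.span_minimal[OF module_mult _ sub])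
  moreover have "f \<in> ideal_power \<nn> (Suc m)" if f: "degs_in {int (Suc m)..} 0 f" for f :: "'k ps2"
  proof -
    \<comment> \<open>The terms free of \<open>y\<close> are divided by \<open>x\<close>, all others
      by \<open>y\<close>.\<close>
    define f1 where "f1 = of_cf (\<lambda>i j. if j = 0 then cf f (Suc i) 0 else 0)"
    define f2 where "f2 = of_cf (\<lambda>i j. cf f i (Suc j))"
    have eq: "f = ps_x * f1 + ps_y * f2"
    proof (rule cf_eqI)
      fix i j
      have "cf (ps_x * f1) i j = (if i \<ge> 1 then cf f1 (i - 1) j else 0)"
        using cf_mon_mult[of 1 0 f1 i j] by (simp add: mon_def)
      moreover have "cf (ps_y * f2) i j = (if j \<ge> 1 then cf f2 i (j - 1) else 0)"
        using cf_mon_mult[of 0 1 f2 i j] by (simp add: mon_def)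
      moreover have "cf f 0 0 = 0"
        using f unfolding degs_in_def by fastforce
      ultimately show "cf f i j = cf (ps_x * f1 + ps_y * f2) i j"
        by (cases i; cases j) (simp_all add: f1_def f2_def)
    qed
    have 0: "cf f i j = 0" if "i + j \<le> m" for i j
      using f that unfolding degs_in_def by fastforce
    have "m \<le> i + j" if "cf f1 i j \<noteq> 0 \<or> cf f2 i j \<noteq> 0" for i j
      using that 0[of "Suc i" j] 0[of i "Suc j"]
      by (auto simp: f1_def f2_def not_less_eq_eq split: if_splits intro: ccontr)
    then have "degs_in {int m..} 0 f1" "degs_in {int m..} 0 f2"
      by (auto simp: degs_in_def simp flip: of_nat_add)
    then have *: "f1 \<in> ideal_power \<nn> m" "f2 \<in> ideal_power \<nn> m"
      using Suc.IH by auto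
    have "ps_x \<in> (\<nn> :: 'k ps2 set)" "ps_y \<in> (\<nn> :: 'k ps2 set)"
      unfolding max_ideal_def by (auto intro: module.span_base[OF module_mult])
    with * have "ps_x * f1 \<in> ideal_power \<nn> (Suc m)" "ps_y * f2 \<in> ideal_power \<nn> (Suc m)"
      unfolding ideal_power.simps by (auto intro!: module.span_base[OF module_mult])
    then show ?thesis
      unfolding eq by (rule ideal_power_add)
  qed
  ultimately show ?case by blast
qed

lemma mem_ideal_power_iff: "f \<in> ideal_power \<nn> m \<longleftrightarrow> (\<forall>i j. i + j < m \<longrightarrow> cf f i j = 0)"
  by (auto simp: ideal_power_max_ideal degs_in_def simp flip: of_nat_add linorder_not_less)

section \<open>The order of a power series\<close>

lemma v_n_eqI:
  assumes "f \<in> ideal_power \<nn> v" "cf f i j \<noteq> 0" "i + j = v"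
  shows "v_n f = v"
  unfolding v_n_def using assms
  by (intro Greatest_equality) (auto simp: mem_ideal_power_iff intro: leI)

text \<open>Any nonzero coefficient bounds the exponents in question, so the greatest one is
  attained.\<close>

lemma mem_ideal_power_v_n:
  assumes "f \<noteq> 0"
  shows "f \<in> ideal_power \<nn> (v_n f)"
proof -
  obtain i j where "cf f i j \<noteq> 0"
    using assms cf_eqI[of f 0] by auto
  then have "v \<le> i + j" if "f \<in> ideal_power \<nn> v" for v
    using that by (auto simp: mem_ideal_power_iff intro: leI)
  moreover have "f \<in> ideal_power \<nn> 0" by simp
  ultimately show ?thesis
    unfolding v_n_def by (rule GreatestI_nat[rotated])
qed

text \<open>The degree is an integer because shifted degrees such as \<open>w - gen_deg j\<close>
  may be negative; the component is then 0.\<close>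

definition hom_part :: "int \<Rightarrow> 'k::field ps2 \<Rightarrow> 'k ps2" where
  "hom_part d f = of_cf (\<lambda>i j. if int (i + j) = d then cf f i j else 0)"

lemma cf_hom_part [simp]: "cf (hom_part d f) i j = (if int (i + j) = d then cf f i j else 0)"
  by (simp add: hom_part_def)

lemma degs_in_hom_part: "degs_in {w} c (hom_part (w - c) f)"
  by (auto simp: degs_in_def)

lemma degs_in_minus_hom_part:
  "degs_in {w..} c f \<Longrightarrow> degs_in {w + 1..} c (f - hom_part (w - c) f)"
  unfolding degs_in_def by (fastforce split: if_splits)

lemma hom_part_unique:
  assumes "degs_in {d} 0 h" "degs_in {d + 1..} 0 (f - h)"
  shows "hom_part d f = h"
proof (rule cf_eqI)
  fix i j
  show "cf (hom_part d f) i j = cf h i j"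
    using assms unfolding degs_in_def
    by (cases "int (i + j) = d") (fastforce)+
qed

section \<open>The associated graded ring as a ring of polynomials\<close>

text \<open>Identifies the associated graded ring with the polynomials inside
  \<open>k[[x,y]]\<close>. The coefficient of \<open>x^i y^j\<close> is read off the representative
  in degree \<open>i + j\<close>, where a change of representative of higher order is
  invisible.\<close>

lift_definition gr_series :: "'k::field gr \<Rightarrow> 'k ps2" is
  "\<lambda>p. of_cf (\<lambda>i j. cf (coeff p (i + j)) i j)"
proof -
  fix p q :: "'k ps2 poly" assume "gr_rel p q"
  then have "cf (coeff p (i + j) - coeff q (i + j)) i j = 0" for i j
    unfolding gr_rel_def mem_ideal_power_iff by blast
  then show "of_cf (\<lambda>i j. cf (coeff p (i + j)) i j) = of_cf (\<lambda>i j. cf (coeff q (i + j)) i j)"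
    by (simp add: of_cf_def)
qed

text \<open>The representative in degree \<open>m\<close> has no terms below degree
  \<open>m\<close>, so its terms of degree exactly \<open>m\<close> determine its class.\<close>

lemma gr_series_inject: "gr_series (F :: 'k::field gr) = gr_series G \<Longrightarrow> F = G"
proof transfer
  fix p q :: "'k ps2 poly"
  assume *: "gr_rel p p" "gr_rel q q"
    "of_cf (\<lambda>i j. cf (coeff p (i + j)) i j) = of_cf (\<lambda>i j. cf (coeff q (i + j)) i j)"
  have eq: "cf (coeff p (i + j)) i j = cf (coeff q (i + j)) i j" for i j
    using arg_cong[OF *(3), of "\<lambda>f. cf f i j"] by simp
  have "cf (coeff p m - coeff q m) i j = 0" if "i + j < Suc m" for m i j
    using * eq[of i j] that unfolding gr_rel_def mem_ideal_power_iff
    by (cases "i + j = m") auto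
  then show "gr_rel p q"
    using *(1,2) by (simp add: gr_rel_def mem_ideal_power_iff del: ideal_power.simps)
qed

lemma gr_series_eq_iff [simp]: "gr_series F = gr_series G \<longleftrightarrow> F = G"
  using gr_series_inject by blast

lemma gr_series_zero [simp]: "gr_series 0 = 0"
  by transfer (auto intro: cf_eqI)

lemma gr_series_add [simp]: "gr_series (F + G) = gr_series F + gr_series G"
  by transfer (auto intro: cf_eqI)

lemma gr_series_diff [simp]: "gr_series (F - G) = gr_series F - gr_series G"
  by transfer (auto intro: cf_eqI)

lemma gr_series_mult [simp]: "gr_series (F * G :: 'k::field gr) = gr_series F * gr_series G"
proof transfer
  fix p q :: "'k ps2 poly"
  assume *: "gr_rel p p" "gr_rel q q"
  have 0: "cf (coeff p m) i j = 0" "cf (coeff q m) i j = 0" if "i + j < m" for m i j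
    using * that by (simp_all add: gr_rel_def mem_ideal_power_iff del: ideal_power.simps)
  show "of_cf (\<lambda>i j. cf (coeff (p * q) (i + j)) i j) =
        of_cf (\<lambda>i j. cf (coeff p (i + j)) i j) * of_cf (\<lambda>i j. cf (coeff q (i + j)) i j)"
  proof (rule cf_eqI)
    fix i j
    let ?T = "\<lambda>m k l. cf (coeff p m) k l * cf (coeff q (i + j - m)) (i - k) (j - l)"
    \<comment> \<open>For \<open>k + l < m\<close> the first factor of \<open>?T m k l\<close>
      vanishes, for \<open>k + l > m\<close> the second.\<close>
    have single: "(\<Sum>m\<le>i + j. ?T m k l) = ?T (k + l) k l" if "k \<le> i" "l \<le> j" for k l
    proof -
      have "?T m k l = (if m = k + l then ?T (k + l) k l else 0)" if "m \<le> i + j" for m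
        using that \<open>k \<le> i\<close> \<open>l \<le> j\<close> 0(1)[of k l m] 0(2)[of "i - k" "j - l" "i + j - m"]
        by (cases m "k + l" rule: linorder_cases) auto
      then have "(\<Sum>m\<le>i + j. ?T m k l) = (\<Sum>m\<le>i + j. if m = k + l then ?T (k + l) k l else 0)"
        by (intro sum.cong refl) (simp only: atMost_iff)
      also have "\<dots> = ?T (k + l) k l"
        using that by (subst sum.delta) auto
      finally show ?thesis .
    qed
    have "cf (coeff (p * q) (i + j)) i j = (\<Sum>m\<le>i + j. \<Sum>l\<le>j. \<Sum>k\<le>i. ?T m k l)"
      by (simp add: coeff_mult cf_sum cf_mult)
    also have "\<dots> = (\<Sum>l\<le>j. \<Sum>m\<le>i + j. \<Sum>k\<le>i. ?T m k l)"
      by (rule sum.swap)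
    also have "\<dots> = (\<Sum>l\<le>j. \<Sum>k\<le>i. \<Sum>m\<le>i + j. ?T m k l)"
      by (rule sum.cong[OF refl], rule sum.swap)
    also have "\<dots> = (\<Sum>l\<le>j. \<Sum>k\<le>i. ?T (k + l) k l)"
      by (intro sum.cong refl) (simp only: single atMost_iff)
    also have "\<dots> = (\<Sum>l\<le>j. \<Sum>k\<le>i. cf (coeff p (k + l)) k l *
                       cf (coeff q (i - k + (j - l))) (i - k) (j - l))"
    proof (intro sum.cong refl)
      fix k l assume "l \<in> {..j}" "k \<in> {..i}"
      then have "i + j - (k + l) = i - k + (j - l)" by auto
      then show "?T (k + l) k l =
          cf (coeff p (k + l)) k l * cf (coeff q (i - k + (j - l))) (i - k) (j - l)"
        by (simp only:)
    qed
    finally show "cf (of_cf (\<lambda>i j. cf (coeff (p * q) (i + j)) i j)) i j =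
        cf (of_cf (\<lambda>i j. cf (coeff p (i + j)) i j) * of_cf (\<lambda>i j. cf (coeff q (i + j)) i j)) i j"
      by (simp only: cf_mult cf_of_cf)
  qed
qed

lemma gr_series_sum: "gr_series (\<Sum>x\<in>A. F x) = (\<Sum>x\<in>A. gr_series (F x))"
  by (induction A rule: infinite_finite_induct) auto

lemma gr_series_gr_class:
  "f \<in> ideal_power \<nn> m \<Longrightarrow> gr_series (gr_class m f) = hom_part (int m) f"
  by transfer (auto intro!: cf_eqI simp flip: of_nat_add)

lemma gr_series_bounded: "\<exists>N. degs_in {..N} 0 (gr_series (F :: 'k::field gr))"
proof transfer
  fix p :: "'k ps2 poly"
  have "cf (coeff p (i + j)) i j \<noteq> 0 \<Longrightarrow> i + j \<le> degree p" for i j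
    by (metis cf_zero le_degree)
  then have "degs_in {..int (degree p)} 0 (of_cf (\<lambda>i j. cf (coeff p (i + j)) i j))"
    by (simp add: degs_in_def flip: of_nat_add)
  then show "\<exists>N. degs_in {..N} 0 (of_cf (\<lambda>i j. cf (coeff p (i + j)) i j))" ..
qed

lemma hom_part_mem: "hom_part (int m) f \<in> ideal_power \<nn> m"
  by (auto simp: mem_ideal_power_iff simp flip: of_nat_add)

text \<open>A preimage is the sum of the classes of the homogeneous components, finite in number by
  the degree bound.\<close>

lemma gr_series_surj:
  assumes "degs_in {..N} 0 f"
  shows "\<exists>F. gr_series F = f"
proof
  have "gr_series (\<Sum>m\<le>nat N. gr_class m (hom_part (int m) f)) =
        (\<Sum>m\<le>nat N. hom_part (int m) f)"
    by (simp add: gr_series_sum gr_series_gr_class hom_part_mem)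
       (intro sum.cong refl cf_eqI, simp)
  also have "\<dots> = f"
  proof (rule cf_eqI)
    fix i j
    have "cf f i j = 0" if "i + j > nat N"
      using assms that unfolding degs_in_def by fastforce
    then show "cf (\<Sum>m\<le>nat N. hom_part (int m) f) i j = cf f i j"
      by (simp add: cf_sum flip: of_nat_add)
  qed
  finally show "gr_series (\<Sum>m\<le>nat N. gr_class m (hom_part (int m) f)) = f" .
qed

text \<open>For negative \<open>d\<close> both sides say \<open>F = 0\<close>; otherwise a
  homogeneous series of degree \<open>d\<close> is its own component of degree
  \<open>d\<close>.\<close>

lemma mem_gr_piece_iff: "F \<in> gr_piece d \<longleftrightarrow> degs_in {d} 0 (gr_series F)"
proof (cases "d < 0")
  case True
  have "degs_in {d} 0 (gr_series F) \<longleftrightarrow> gr_series F = gr_series 0"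
    using True by (auto simp: degs_in_def intro!: cf_eqI simp flip: gr_series_eq_iff)
  then show ?thesis
    using True unfolding gr_piece_def by (simp del: gr_series_zero)
next
  case False
  show ?thesis
  proof
    assume "F \<in> gr_piece d"
    then obtain f where "f \<in> ideal_power \<nn> (nat d)" "F = gr_class (nat d) f"
      using False unfolding gr_piece_def by auto
    then show "degs_in {d} 0 (gr_series F)"
      using degs_in_hom_part[of d 0 f] False by (simp add: gr_series_gr_class)
  next
    assume *: "degs_in {d} 0 (gr_series F)"
    have "hom_part d (gr_series F) = gr_series F"
      using * by (intro hom_part_unique) auto
    then have "gr_series F \<in> ideal_power \<nn> (nat d)" "gr_series (gr_class (nat d) (gr_series F)) = gr_series F"
      using hom_part_mem[of "nat d" "gr_series F"] False by (auto simp: gr_series_gr_class)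
    then show "F \<in> gr_piece d"
      using False unfolding gr_piece_def by (metis gr_series_inject image_eqI)
  qed
qed

definition gr_mon :: "nat \<Rightarrow> nat \<Rightarrow> 'k::field gr" where
  "gr_mon p q = gr_class (p + q) (mon p q)"

lemma gr_series_gr_mon [simp]: "gr_series (gr_mon p q) = mon p q"
proof -
  have "mon p q \<in> ideal_power \<nn> (p + q)"
    by (simp add: mem_ideal_power_iff cf_mon)
  then show ?thesis
    unfolding gr_mon_def gr_series_gr_class[OF \<open>mon p q \<in> _\<close>]
    by (intro hom_part_unique) (auto intro: degs_in_mon)
qed

lemma gr_mon_irrelevant: "0 < p + q \<Longrightarrow> gr_mon p q \<in> irrelevant_ideal"
  unfolding irrelevant_ideal_def
  by (intro module.span_base[OF module_mult] UN_I[of "int (p + q)"])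
     (auto simp: mem_gr_piece_iff intro: degs_in_mon)

section \<open>Ideals with one or two generators\<close>

lemma ideal_gen_single: "h \<in> ideal_gen {f} \<longleftrightarrow> f dvd h"
  by (auto simp: module.span_singleton[OF module_mult] dvd_def mult.commute)

lemma ideal_gen_pair: "h \<in> ideal_gen {f, g} \<longleftrightarrow> (\<exists>u v. h = u * f + v * g)"
proof -
  have "h \<in> ideal_gen {f, g} \<longleftrightarrow> (\<exists>u v. h - u * f = g * v)"
    unfolding module.span_insert[OF module_mult, of f "{g}"] mem_Collect_eq ideal_gen_single dvd_def ..
  then show ?thesis by (simp add: diff_eq_eq add.commute mult.commute)
qed

section \<open>The staircase and its syzygies\<close>

text \<open>
  The indices run from \<open>1\<close> to \<open>n\<close>; \<open>d 1\<close> and \<open>s 1\<close> are irrelevant. The type parameter only fixes the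
  ground field.
\<close>

locale staircase =
  fixes n :: nat and p t d s :: "nat \<Rightarrow> nat" and field_type :: "'k::field itself"
  assumes n: "2 \<le> n"
    and p_step: "\<And>j. 1 \<le> j \<Longrightarrow> j < n \<Longrightarrow> p j = d (Suc j) + p (Suc j)"
    and p_last: "p n = 0"
    and t_first: "t 1 = 0"
    and t_step: "\<And>j. 1 \<le> j \<Longrightarrow> j < n \<Longrightarrow> t (Suc j) = t j + s (Suc j)"
    and d_pos: "\<And>j. 2 \<le> j \<Longrightarrow> j \<le> n \<Longrightarrow> 0 < d j"
    and s_pos: "\<And>j. 2 \<le> j \<Longrightarrow> j \<le> n \<Longrightarrow> 0 < s j"
    and gap: "\<And>j. 1 \<le> j \<Longrightarrow> Suc (Suc j) \<le> n \<Longrightarrow> p j < s (Suc (Suc j)) + p (Suc (Suc j))"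
begin

lemma one_le_n: "1 \<le> n"
  using n by simp

text \<open>The degree of the monomial \<open>m_j\<close>; it becomes \<open>c j\<close> in the
  application, and \<open>syz_deg j\<close> becomes \<open>e j\<close>.\<close>

definition gen_deg :: "nat \<Rightarrow> int" where
  "gen_deg j = int (p j + t j)"

definition syz_deg :: "nat \<Rightarrow> int" where
  "syz_deg j = int (p j + t j + d j)"

text \<open>The degree of a relation between neighbours, read off its other side.\<close>

lemma syz_deg_Suc:
  assumes "1 \<le> j" "j < n"
  shows "syz_deg (Suc j) = gen_deg j + int (s (Suc j))"
  using p_step[OF assms] t_step[OF assms] by (simp add: syz_deg_def gen_deg_def)

text \<open>This is \<open>gap\<close> at \<open>j - 1\<close>, and corresponds to the hypothesis
  \<open>e j < c (j + 1)\<close>.\<close>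

lemma syz_deg_less_gen_deg:
  assumes "2 \<le> j" "j < n"
  shows "syz_deg j < gen_deg (Suc j)"
proof -
  have "p (j - 1) = d j + p j" "t (Suc j) = t j + s (Suc j)" "p (j - 1) < s (Suc j) + p (Suc j)"
    using p_step[of "j - 1"] t_step[of j] gap[of "j - 1"] assms by simp_all
  then show ?thesis by (simp add: syz_deg_def gen_deg_def)
qed

text \<open>Entry \<open>j\<close> of the combination of the neighbour relations with coefficients
  \<open>w\<close>: relation \<open>j\<close> contributes through \<open>x^(d j)\<close>, relation
  \<open>j + 1\<close> through \<open>y^(s (j + 1))\<close>.\<close>

definition syz :: "(nat \<Rightarrow> 'k ps2) \<Rightarrow> nat \<Rightarrow> 'k ps2" where
  "syz w j = mon (d j) 0 * w j - mon 0 (s (Suc j)) * w (Suc j)"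

section \<open>Syzygies of the staircase monomials\<close>

lemma p_antimono:
  assumes "1 \<le> j" "j \<le> m" "m \<le> n"
  shows "p m \<le> p j"
  using assms(2,3)
proof (induction m rule: dec_induct)
  case (step m)
  then show ?case using p_step[of m] assms(1) by simp
qed simp

text \<open>Induction on the number of monomials. All but the last are divisible by
  \<open>x^(p m)\<close>, which forces \<open>x^(d (m + 1))\<close> to divide the last coefficient;
  a multiple of the last relation then removes that term.\<close>

lemma syzygy_exists:
  fixes u :: "nat \<Rightarrow> 'k ps2"
  assumes "1 \<le> m" "m \<le> n" "(\<Sum>j=1..m. u j * mon (p j) (t j)) = 0"
  shows "\<exists>w. (\<forall>j. j \<notin> {2..m} \<longrightarrow> w j = 0) \<and> (\<forall>j\<in>{1..m}. u j = syz w j)"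
  using assms
proof (induction m arbitrary: u rule: dec_induct)
  case base
  then show ?case by (auto intro!: exI[of _ "\<lambda>_. 0"] simp: syz_def)
next
  case (step m)
  have p: "p m = d (Suc m) + p (Suc m)" and t: "t (Suc m) = t m + s (Suc m)"
    using p_step[of m] t_step[of m] step by auto
  have "mon (p m) 0 dvd u j * mon (p j) (t j)" if "j \<in> {1..m}" for j
  proof -
    have "mon (p j) (t j) = (mon (p m) 0 * mon (p j - p m) (t j) :: 'k ps2)"
      using p_antimono[of j m] that step by (simp add: mon_mult)
    then show ?thesis by simp
  qed
  then have dvd: "mon (p m) 0 dvd (\<Sum>j=1..m. u j * mon (p j) (t j))"
    by (intro dvd_sum)
  have sum0: "(\<Sum>j=1..m. u j * mon (p j) (t j)) + u (Suc m) * mon (p (Suc m)) (t (Suc m)) = 0"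
    using step by simp
  then have "mon (p m) 0 dvd
      (\<Sum>j=1..m. u j * mon (p j) (t j)) + u (Suc m) * mon (p (Suc m)) (t (Suc m))"
    by (simp only: dvd_0_right)
  then have "mon (p m) 0 dvd u (Suc m) * mon (p (Suc m)) (t (Suc m))"
    by (simp only: dvd_add_right_iff[OF dvd])
  moreover have "u (Suc m) * mon (p (Suc m)) (t (Suc m)) =
      mon (p (Suc m)) 0 * (mon 0 (t (Suc m)) * u (Suc m))"
    by (simp add: mon_mult_left)
  moreover have "mon (p m) 0 = (mon (p (Suc m)) 0 * mon (d (Suc m)) 0 :: 'k ps2)"
    by (simp add: mon_mult p add.commute)
  ultimately have "mon (d (Suc m)) 0 dvd mon 0 (t (Suc m)) * u (Suc m)"
    by simp
  \<comment> \<open>Multiplication by a power of \<open>y\<close> only shifts coefficients, so it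
    does not affect divisibility by a power of \<open>x\<close>.\<close>
  then have "cf (mon 0 (t (Suc m)) * u (Suc m)) i (j + t (Suc m)) = 0" if "i < d (Suc m)" for i j
    using that unfolding mon_0_dvd_iff by blast
  then have "mon (d (Suc m)) 0 dvd u (Suc m)"
    unfolding mon_0_dvd_iff by (simp add: cf_mon_mult)
  then obtain w where w: "u (Suc m) = mon (d (Suc m)) 0 * w" ..
  \<comment> \<open>Subtracting \<open>w\<close> times the last relation clears entry
    \<open>m + 1\<close> and changes only entry \<open>m\<close> among the others.\<close>
  define u' where "u' = u(m := u m + mon 0 (s (Suc m)) * w)"
  have m: "{1..m} = insert m {1..<m}" using step by auto
  have "(\<Sum>j=1..m. u' j * mon (p j) (t j)) =
      (\<Sum>j=1..m. u j * mon (p j) (t j)) + mon 0 (s (Suc m)) * w * mon (p m) (t m)"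
    unfolding m by (simp add: u'_def algebra_simps)
  also have "mon 0 (s (Suc m)) * w * mon (p m) (t m) = u (Suc m) * mon (p (Suc m)) (t (Suc m))"
    by (simp add: w p t mult_ac mon_mult_left mon_mult) (simp add: add.commute)
  finally have "(\<Sum>j=1..m. u' j * mon (p j) (t j)) = 0"
    by (simp only: sum0)
  then obtain w' where w': "\<And>j. j \<notin> {2..m} \<Longrightarrow> w' j = 0" "\<And>j. j \<in> {1..m} \<Longrightarrow> u' j = syz w' j"
    using step.IH[of u'] step.prems Suc_leD by blast
  show ?case
  proof (intro exI[of _ "w'(Suc m := w)"] conjI allI ballI impI)
    fix j assume "j \<notin> {2..Suc m}"
    then show "(w'(Suc m := w)) j = 0" using w'(1) step(1) by auto
  next
    fix j assume "j \<in> {1..Suc m}"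
    then consider "j < m" "1 \<le> j" | "j = m" | "j = Suc m" by fastforce
    then show "u j = syz (w'(Suc m := w)) j"
    proof cases
      case 1
      then show ?thesis using w'(2)[of j] by (simp add: u'_def syz_def)
    next
      case 2
      then show ?thesis using w'(2)[of m] w'(1)[of "Suc m"] step(1)
        by (simp add: u'_def syz_def algebra_simps)
    next
      case 3
      then show ?thesis using w'(1)[of "Suc (Suc m)"] by (simp add: w syz_def)
    qed
  qed
qed

text \<open>Descending induction from \<open>w (n + 1) = 0\<close>, solving
  \<open>u j = syz w j\<close> for \<open>x^(d j) w j\<close>. The sets \<open>{w}\<close>,
  \<open>{..M}\<close> and \<open>{}\<close> for \<open>Z\<close> later give homogeneity,
  boundedness and uniqueness of \<open>w\<close>.\<close>

lemma syzygy_degs_in: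
  fixes u w :: "nat \<Rightarrow> 'k ps2"
  assumes w0: "\<And>j. j \<notin> {2..n} \<Longrightarrow> w j = 0"
    and uw: "\<And>j. j \<in> {1..n} \<Longrightarrow> u j = syz w j"
    and u: "\<And>j. j \<in> {1..n} \<Longrightarrow> degs_in Z (gen_deg j) (u j)"
    and i: "2 \<le> i" "i \<le> Suc n"
  shows "degs_in Z (syz_deg i) (w i)"
  using i(2)
proof (induction rule: inc_induct)
  case base
  then show ?case using w0 by simp
next
  case (step j)
  then have j: "2 \<le> j" "j \<le> n" using i by auto
  have "degs_in Z (gen_deg j) (mon 0 (s (Suc j)) * w (Suc j))"
  proof (cases "j = n")
    case True
    then show ?thesis using w0 by simp
  next
    case False
    then show ?thesis using step.IH syz_deg_Suc[of j] j by (simp add: degs_in_mon_mult)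
  qed
  then have "degs_in Z (gen_deg j) (u j + mon 0 (s (Suc j)) * w (Suc j))"
    using u[of j] j by (intro degs_in_add) auto
  then have "degs_in Z (gen_deg j) (mon (d j) 0 * w j)"
    using uw[of j] j by (simp add: syz_def)
  then show ?case
    by (simp add: degs_in_mon_mult syz_deg_def gen_deg_def)
qed

text \<open>The series \<open>h\<^sub>j\<close>, first with the index reversed (\<open>h\<^sub>j\<close> is \<open>rev_cont (n + 1 - j)\<close>).\<close>

fun rev_cont :: "nat \<Rightarrow> 'k ps2" where
  "rev_cont 0 = 0"
| "rev_cont (Suc 0) = 1"
| "rev_cont (Suc (Suc k)) =
     mon (d (n - k)) 0 * rev_cont (Suc k) - mon 0 (s (Suc n - k)) * rev_cont k"

definition cont :: "nat \<Rightarrow> 'k ps2" where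
  "cont j = rev_cont (Suc n - j)"

lemma cont_Suc_n [simp]: "cont (Suc n) = 0"
  and cont_n [simp]: "cont n = 1"
  by (simp_all add: cont_def)

lemma cont_step:
  assumes "j < n"
  shows "cont j = mon (d (Suc j)) 0 * cont (Suc j) - mon 0 (s (Suc (Suc j))) * cont (Suc (Suc j))"
proof -
  obtain k where "n = Suc (j + k)"
    using assms less_iff_Suc_add by auto
  then have "Suc n - j = Suc (Suc k)" "Suc n - Suc j = Suc k" "Suc n - Suc (Suc j) = k"
    "n - k = Suc j" "Suc n - k = Suc (Suc j)" by simp_all
  then show ?thesis by (simp only: cont_def rev_cont.simps)
qed

text \<open>Follows the recursion downwards from \<open>n\<close>; the second predecessor is
  supplied only if its index is at most \<open>n\<close>.\<close>

lemma cont_induct [consumes 1, case_names last step]: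
  assumes "j \<le> n" "P n"
    and "\<And>j. j < n \<Longrightarrow> P (Suc j) \<Longrightarrow> (Suc (Suc j) \<le> n \<Longrightarrow> P (Suc (Suc j))) \<Longrightarrow> P j"
  shows "P j"
  using assms(1)
proof (induction "n - j" arbitrary: j rule: less_induct)
  case less
  show ?case
  proof (cases "j = n")
    case False
    then have "j < n" using less.prems by simp
    then show ?thesis
      by (rule assms(3)) (use \<open>j < n\<close> in \<open>auto intro: less.hyps\<close>)
  qed (use assms(2) in simp)
qed

text \<open>The first term of the recursion carries \<open>x^(p (j + 1))\<close> to
  \<open>x^(p j)\<close>; by \<open>gap\<close> the second has order above
  \<open>p j\<close>.\<close>

lemma cont_lead:
  assumes "1 \<le> j" "j \<le> n"
  shows "degs_in {int (p j) + 1..} 0 (cont j - mon (p j) 0 :: 'k ps2)"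
  using assms(2,1)
proof (induction j rule: cont_induct)
  case last
  then show ?case by (simp add: p_last)
next
  case (step j)
  have p: "p j = d (Suc j) + p (Suc j)" using p_step step by simp
  have "degs_in {int (p j) + 1..} 0 (mon 0 (s (Suc (Suc j))) * cont (Suc (Suc j)) :: 'k ps2)"
  proof (cases "Suc j = n")
    case False
    then have le: "Suc (Suc j) \<le> n" using step by simp
    let ?q = "p (Suc (Suc j))"
    have "degs_in {int ?q..} 0 (cont (Suc (Suc j)) - mon ?q 0 + mon ?q 0 :: 'k ps2)"
      by (intro degs_in_add degs_in_mon degs_in_mono[OF step.IH(2)[OF le]]) auto
    then have "degs_in {int ?q..} 0 (cont (Suc (Suc j)) :: 'k ps2)" by simp
    then show ?thesis
      unfolding degs_in_mon_mult degs_in_atLeast_shift[of _ "0 + _"]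
      by (rule degs_in_mono) (use gap[OF step.prems le] in auto)
  qed (metis cont_Suc_n degs_in_zero mult_zero_right)
  moreover have "degs_in {int (p j) + 1..} 0
      (mon (d (Suc j)) 0 * (cont (Suc j) - mon (p (Suc j)) 0) :: 'k ps2)"
    using step.IH(1) unfolding degs_in_mon_mult degs_in_atLeast_shift[of _ "0 + _"]
    by (simp add: p add.commute)
  ultimately show ?case
    unfolding cont_step[OF \<open>j < n\<close>]
    using degs_in_diff by (fastforce simp: p mon_mult algebra_simps)
qed

text \<open>Modulo \<open>y\<close> only the first term of the recursion survives, since
  \<open>s\<close> is positive; so \<open>cont j\<close> reduces to \<open>x^(p j)\<close>.\<close>

lemma cf_cont_0:
  assumes "1 \<le> j" "j \<le> n"
  shows "cf (cont j) i 0 = (if i = p j then 1 else 0)"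
  using assms(2,1)
proof (induction j arbitrary: i rule: cont_induct)
  case last
  then show ?case by (simp add: p_last cf_one)
next
  case (step j)
  then have "p j = d (Suc j) + p (Suc j)" using p_step by simp
  moreover have "cf (mon 0 (s (Suc (Suc j))) * cont (Suc (Suc j))) i 0 = 0"
  proof (cases "Suc j = n")
    case True
    then show ?thesis by (metis cf_zero cont_Suc_n mult_zero_right)
  next
    case False
    then show ?thesis using s_pos[of "Suc (Suc j)"] step by (simp add: cf_mon_mult)
  qed
  ultimately show ?case
    unfolding cont_step[OF \<open>j < n\<close>] using step.IH(1) by (auto simp: cf_mon_mult)
qed

section \<open>Coprimality of consecutive remainders\<close>

lemma cont_nonzero: "1 \<le> j \<Longrightarrow> j \<le> n \<Longrightarrow> cont j \<noteq> 0"
  using cf_cont_0[of j "p j"] by auto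

text \<open>If \<open>y\<close> divides \<open>cont j * r\<close>, it divides \<open>r\<close>,
  because \<open>cont j\<close> is nonzero modulo \<open>y\<close>. The powers of \<open>y\<close>
  are cancelled one at a time.\<close>

lemma cont_dvd_y_cancel:
  assumes j: "1 \<le> j" "j \<le> n" and "cont j dvd mon 0 q * f"
  shows "cont j dvd f"
  using assms(3)
proof (induction q)
  case (Suc q)
  have "mon 0 (Suc q) * f = ps_y * (mon 0 q * f)"
    by (simp add: mon_def mult_ac)
  with Suc.prems obtain r where r: "ps_y * (mon 0 q * f) = cont j * r" by (auto elim: dvdE)
  have "fps_nth (cont j) 0 = fps_X ^ p j"
    using cf_cont_0[OF j] by (intro fps_ext) (simp add: cf_def)
  moreover have "fps_nth (cont j * r) 0 = 0"
    unfolding r[symmetric] by (simp add: ps_y_def)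
  ultimately have "fps_nth r 0 = 0" by simp
  then have "r = ps_y * fps_shift 1 r"
    by (intro fps_ext) (simp add: ps_y_def)
  with r have "ps_y * (mon 0 q * f) = ps_y * (cont j * fps_shift 1 r)"
    by (metis mult.left_commute)
  then have "mon 0 q * f = cont j * fps_shift 1 r" by (simp add: ps_y_def)
  then show ?case using Suc.IH by simp
qed simp

text \<open>The Euclidean argument for coprimality: modulo \<open>cont (j + 1)\<close> the recursion
  replaces \<open>cont j\<close> by a power of \<open>y\<close> times \<open>cont (j + 2)\<close>,
  up to sign. The power of \<open>y\<close> cancels, and the chain ends at
  \<open>cont n = 1\<close>.\<close>

lemma cont_dvd_cancel:
  assumes "1 \<le> j" "j \<le> n" and "cont j dvd cont (Suc j) * f"
  shows "cont j dvd f"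
  using assms(2,1,3)
proof (induction j arbitrary: f rule: cont_induct)
  case (step j)
  from \<open>cont j dvd cont (Suc j) * f\<close> obtain r where r: "cont (Suc j) * f = cont j * r" ..
  have "mon 0 (s (Suc (Suc j))) * (cont (Suc (Suc j)) * r) = cont (Suc j) * (mon (d (Suc j)) 0 * r - f)"
    using r unfolding cont_step[OF \<open>j < n\<close>] by (simp add: algebra_simps)
  then have "cont (Suc j) dvd mon 0 (s (Suc (Suc j))) * (cont (Suc (Suc j)) * r)" by simp
  then have "cont (Suc j) dvd cont (Suc (Suc j)) * r"
    by (rule cont_dvd_y_cancel[rotated 2]) (use \<open>j < n\<close> in auto)
  then have "cont (Suc j) dvd r"
    by (rule step.IH(1)[rotated]) simp
  then obtain r' where "r = cont (Suc j) * r'" ..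
  then have "cont (Suc j) * f = cont (Suc j) * (cont j * r')"
    using r by (simp add: mult_ac)
  then have "f = cont j * r'"
    using cont_nonzero[of "Suc j"] step by simp
  then show ?case by simp
qed simp

section \<open>The elements of the standard basis\<close>

definition basis :: "nat \<Rightarrow> 'k ps2" where
  "basis j = mon 0 (t j) * cont j"

lemma basis_Suc_n [simp]: "basis (Suc n) = 0"
  by (simp add: basis_def)

text \<open>The recursion multiplied by \<open>y^(t (j + 1))\<close>. It lifts relation
  \<open>j + 1\<close> of the monomials, with remainder \<open>basis (j + 2)\<close>, which is 0 at
  the end.\<close>

lemma basis_relation:
  assumes "1 \<le> j" "j < n"
  shows "mon (d (Suc j)) 0 * basis (Suc j) - mon 0 (s (Suc j)) * basis j = basis (Suc (Suc j))"
proof -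
  have "mon (d (Suc j)) 0 * basis (Suc j) - mon 0 (s (Suc j)) * basis j =
      mon 0 (t (Suc j)) * (mon (d (Suc j)) 0 * cont (Suc j) - cont j)"
    by (simp add: basis_def mon_mult_left t_step[OF assms] algebra_simps)
  also have "\<dots> = mon 0 (t (Suc j) + s (Suc (Suc j))) * cont (Suc (Suc j))"
    by (simp add: cont_step[OF assms(2)] mon_mult_left)
  also have "\<dots> = basis (Suc (Suc j))"
  proof (cases "Suc j = n")
    case True
    then show ?thesis by (metis basis_Suc_n cont_Suc_n mult_zero_right)
  next
    case False
    then show ?thesis using t_step[of "Suc j"] assms by (simp add: basis_def)
  qed
  finally show ?thesis .
qed

lemma basis_lead:
  assumes "1 \<le> j" "j \<le> n"
  shows "degs_in {gen_deg j + 1..} 0 (basis j - mon (p j) (t j))"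
proof -
  have "basis j - mon (p j) (t j) = mon 0 (t j) * (cont j - mon (p j) 0)"
    by (simp add: basis_def algebra_simps mon_mult)
  moreover have "degs_in {gen_deg j + 1..} 0 (mon 0 (t j) * (cont j - mon (p j) 0))"
    using cont_lead[OF assms] unfolding degs_in_mon_mult degs_in_atLeast_shift[of _ "0 + _"]
    by (simp add: gen_deg_def)
  ultimately show ?thesis by simp
qed

lemma basis_order:
  assumes "1 \<le> j" "j \<le> n"
  shows "degs_in {gen_deg j..} 0 (basis j)"
proof -
  have "degs_in {gen_deg j..} 0 (basis j - mon (p j) (t j) + mon (p j) (t j))"
    by (intro degs_in_add degs_in_mon degs_in_mono[OF basis_lead[OF assms]])
       (auto simp: gen_deg_def)
  then show ?thesis by simp
qed

lemma basis_mem_power: "1 \<le> j \<Longrightarrow> j \<le> n \<Longrightarrow> basis j \<in> ideal_power \<nn> (p j + t j)"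
  using basis_order by (simp add: ideal_power_max_ideal gen_deg_def)

lemma cf_basis: "1 \<le> j \<Longrightarrow> j \<le> n \<Longrightarrow> cf (basis j) (p j) (t j) = 1"
  using cf_cont_0[of j "p j"] by (simp add: basis_def cf_mon_mult)

lemma v_n_basis: "1 \<le> j \<Longrightarrow> j \<le> n \<Longrightarrow> v_n (basis j) = p j + t j"
  using basis_mem_power cf_basis by (intro v_n_eqI) auto

lemma initial_form_basis:
  assumes "1 \<le> j" "j \<le> n"
  shows "initial_form (basis j) = gr_mon (p j) (t j)"
proof (rule gr_series_inject)
  have "hom_part (gen_deg j) (basis j) = mon (p j) (t j)"
    by (rule hom_part_unique[OF degs_in_mon basis_lead[OF assms]]) (simp add: gen_deg_def)
  then show "gr_series (initial_form (basis j)) = gr_series (gr_mon (p j) (t j))"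
    using basis_mem_power[OF assms]
    by (simp add: initial_form_def v_n_basis[OF assms] gr_series_gr_class gen_deg_def)
qed

lemma basis_mem_ideal:
  assumes "1 \<le> j" "j \<le> n"
  shows "basis j \<in> ideal_gen {basis 1, basis 2}"
proof -
  \<comment> \<open>Two consecutive elements are carried along, since \<open>basis_relation\<close>
    obtains the next from both.\<close>
  have "basis j \<in> ideal_gen {basis 1, basis 2} \<and> basis (Suc j) \<in> ideal_gen {basis 1, basis 2}"
    using assms
  proof (induction j rule: dec_induct)
    case base
    then show ?case by (simp add: module.span_base[OF module_mult] numeral_2_eq_2)
  next
    case (step i)
    then have "mon (d (Suc i)) 0 * basis (Suc i) - mon 0 (s (Suc i)) * basis i
        \<in> ideal_gen {basis 1, basis 2}"
      by (intro module.span_diff[OF module_mult] module.span_scale[OF module_mult]) auto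
    then show ?case
      using basis_relation[of i] step by simp
  qed
  then show ?thesis ..
qed

text \<open>Since \<open>t 1 = 0\<close>, the first element is \<open>cont 1\<close>, which is
  nonzero in a domain. Modulo it, the factors \<open>y^(t 2)\<close> and \<open>cont 2\<close> of
  the second can be cancelled in turn. Both constant terms vanish, so the ideal is proper.\<close>

lemma regular_sequence_basis:
  assumes "0 < p 1"
  shows "regular_sequence [basis 1, basis 2 :: 'k ps2]"
  unfolding regular_sequence_def
proof (intro conjI allI impI)
  have b1: "basis 1 = cont 1" unfolding basis_def t_first by simp
  fix i and h :: "'k ps2"
  assume i: "i < length [basis 1, basis 2 :: 'k ps2]"
    and h: "[basis 1, basis 2] ! i * h \<in> ideal_gen (set (take i [basis 1, basis 2]))"
  show "h \<in> ideal_gen (set (take i [basis 1, basis 2]))"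
  proof (cases "i = 0")
    case True
    then show ?thesis
      using h cont_nonzero[of 1] n b1 by (simp add: module.span_empty[OF module_mult])
  next
    case False
    then have "i = 1" using i by simp
    then have "cont 1 dvd mon 0 (t 2) * (cont (Suc 1) * h)"
      using h b1 by (simp add: ideal_gen_single basis_def[of "Suc (Suc 0)"] numeral_2_eq_2 mult.assoc)
    then have "cont 1 dvd cont (Suc 1) * h"
      by (rule cont_dvd_y_cancel[rotated 2]) (use n in auto)
    then have "cont 1 dvd h"
      by (rule cont_dvd_cancel[rotated 2]) (use n in auto)
    then show ?thesis
      using \<open>i = 1\<close> b1 by (simp add: ideal_gen_single)
  qed
next
  have "cf (basis 1) 0 0 = 0"
    using basis_mem_power[of 1] n assms unfolding mem_ideal_power_iff by simp
  moreover have "0 < t 2"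
    using t_step[of 1] s_pos[of 2] n by (simp add: numeral_2_eq_2)
  then have "cf (basis 2) 0 0 = 0"
    using basis_mem_power[of 2] n unfolding mem_ideal_power_iff by simp
  ultimately have "cf (u * basis 1 + v * basis 2) 0 0 = 0" for u v :: "'k ps2"
    by (simp add: cf_mult)
  moreover have "cf (1 :: 'k ps2) 0 0 \<noteq> 0"
    by (simp add: cf_one)
  ultimately have "1 \<notin> ideal_gen {basis 1, basis 2 :: 'k ps2}"
    unfolding ideal_gen_pair by metis
  then show "ideal_gen (set [basis 1, basis 2 :: 'k ps2]) \<noteq> UNIV" by auto
qed

section \<open>The standard basis property\<close>

text \<open>With \<open>h\<close> the leading component of \<open>u\<close> and \<open>m\<close>
  that of \<open>g\<close>, write \<open>u g - h m = (u - h) g + h (g - m)\<close>; both summands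
  have order above \<open>w\<close>.\<close>

lemma leading_part:
  assumes u: "\<And>j. j \<in> {1..n} \<Longrightarrow> degs_in {w..} (gen_deg j) (u j)"
  shows "degs_in {w + 1..} 0
    ((\<Sum>j=1..n. u j * basis j) - (\<Sum>j=1..n. hom_part (w - gen_deg j) (u j) * mon (p j) (t j)))"
proof -
  let ?h = "\<lambda>j. hom_part (w - gen_deg j) (u j)"
  have "degs_in {w + 1..} 0 (u j * basis j - ?h j * mon (p j) (t j))" if j: "j \<in> {1..n}" for j
  proof -
    have "degs_in {w + 1 - gen_deg j..} 0 (u j - ?h j)"
      using degs_in_minus_hom_part[OF u[OF j]] by (simp only: degs_in_atLeast_shift[of _ "gen_deg j"])
    then have 1: "degs_in {w + 1..} 0 ((u j - ?h j) * basis j)"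
      using degs_in_mult[OF _ basis_order[of j]] j by fastforce
    have "degs_in {w - gen_deg j..} 0 (?h j)"
      by (rule degs_in_mono[of "{w - gen_deg j}"]) (auto simp: degs_in_def)
    then have 2: "degs_in {w + 1..} 0 (?h j * (basis j - mon (p j) (t j)))"
      using degs_in_mult[OF _ basis_lead[of j]] j by fastforce
    show ?thesis
      using degs_in_add[OF 1 2] by (simp add: algebra_simps)
  qed
  then show ?thesis
    unfolding sum_subtractf[symmetric] by (rule degs_in_sum)
qed

text \<open>Summation by parts: each lifted relation \<open>j\<close> is replaced by its remainder
  \<open>basis (j + 1)\<close>. For \<open>m = n\<close> and \<open>q (n + 1) = 0\<close> the
  boundary terms vanish.\<close>

lemma sum_syz_basis:
  assumes "1 \<le> m" "m \<le> n" and q: "q 0 = 0" "q 1 = 0"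
  shows "(\<Sum>j=1..m. syz q j * basis j) =
    (\<Sum>j=1..m. q (j - 1) * basis j) + q m * basis (Suc m) - mon 0 (s (Suc m)) * q (Suc m) * basis m"
  using assms(1,2)
proof (induction m rule: dec_induct)
  case base
  then show ?case using q by (simp add: syz_def algebra_simps)
next
  case (step m)
  then have eq: "basis (Suc (Suc m)) = mon (d (Suc m)) 0 * basis (Suc m) - mon 0 (s (Suc m)) * basis m"
    using basis_relation[of m] by simp
  show ?case
    using step by (simp add: eq syz_def algebra_simps)
qed

text \<open>The same summation for the monomials, whose relations have no remainder.\<close>

lemma sum_syz_mon:
  assumes "1 \<le> m" "m \<le> n" and q: "q 1 = 0"
  shows "(\<Sum>j=1..m. syz q j * mon (p j) (t j)) = - (mon 0 (s (Suc m)) * q (Suc m) * mon (p m) (t m))"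
  using assms(1,2)
proof (induction m rule: dec_induct)
  case base
  then show ?case using q by (simp add: syz_def)
next
  case (step m)
  have eq: "mon 0 (s (Suc m)) * mon (p m) (t m) = mon (d (Suc m)) 0 * mon (p (Suc m)) (t (Suc m))"
    using p_step[of m] t_step[of m] step by (simp add: mon_mult add.commute)
  have q: "mon 0 (s (Suc m)) * q (Suc m) * mon (p m) (t m) =
      mon (d (Suc m)) 0 * q (Suc m) * mon (p (Suc m)) (t (Suc m))"
    using arg_cong[OF eq, of "(*) (q (Suc m))"] by (simp only: mult_ac)
  have "(\<Sum>j=1..Suc m. syz q j * mon (p j) (t j)) =
      - (mon 0 (s (Suc m)) * q (Suc m) * mon (p m) (t m)) + syz q (Suc m) * mon (p (Suc m)) (t (Suc m))"
    using step by simp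
  then show ?case
    unfolding q by (simp add: syz_def left_diff_distrib)
qed

text \<open>The leading components of the \<open>u j\<close> form a syzygy of the monomials. Its
  lift trades them for remainders, which have larger order by
  \<open>syz_deg_less_gen_deg\<close>.\<close>

lemma improve_representation:
  fixes u :: "nat \<Rightarrow> 'k ps2"
  assumes u: "\<And>j. j \<in> {1..n} \<Longrightarrow> degs_in {w..} (gen_deg j) (u j)"
    and F: "F = (\<Sum>j=1..n. u j * basis j)" "degs_in {w + 1..} 0 F"
  shows "\<exists>v. (\<forall>j\<in>{1..n}. degs_in {w + 1..} (gen_deg j) (v j)) \<and> F = (\<Sum>j=1..n. v j * basis j)"
proof -
  define h where "h j = hom_part (w - gen_deg j) (u j)" for j
  let ?R = "\<Sum>j=1..n. h j * mon (p j) (t j)"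
  have h: "degs_in {w} (gen_deg j) (h j)" for j
    unfolding h_def by (rule degs_in_hom_part)
  have "degs_in {w + 1..} 0 (F - (F - ?R))"
    using leading_part[OF u] F(2) unfolding F(1) h_def by (rule degs_in_diff[rotated])
  moreover have "degs_in {w} 0 ?R"
    using h by (intro degs_in_sum) (simp add: mult.commute[of "h _"] degs_in_mon_mult gen_deg_def)
  \<comment> \<open>It is homogeneous of degree \<open>w\<close> and has order above
    \<open>w\<close>.\<close>
  ultimately have "?R = 0"
    using degs_in_disjoint[of "{w + 1..}" 0 ?R "{w}"] by simp
  then obtain q where q0: "\<And>j. j \<notin> {2..n} \<Longrightarrow> q j = 0" and hq: "\<And>j. j \<in> {1..n} \<Longrightarrow> h j = syz q j"
    using syzygy_exists[of n h] one_le_n by blast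
  have q: "degs_in {w} (syz_deg j) (q j)" if "2 \<le> j" "j \<le> n" for j
    by (rule syzygy_degs_in[OF q0 hq h]) (use that in auto)
  show ?thesis
  \<comment> \<open>The summand \<open>q (j - 1)\<close> appears because \<open>basis j\<close> is
    the remainder of relation \<open>j - 1\<close>.\<close>
  proof (intro exI[of _ "\<lambda>j. u j - h j + q (j - 1)"] conjI ballI)
    fix j assume j: "j \<in> {1..n}"
    have "degs_in {w + 1..} (gen_deg j) (q (j - 1))"
    proof (cases "j \<le> 2")
      case True
      then show ?thesis using q0[of "j - 1"] by simp
    next
      case False
      then have "degs_in {w} (syz_deg (j - 1)) (q (j - 1))" "syz_deg (j - 1) < gen_deg j"
        using q[of "j - 1"] syz_deg_less_gen_deg[of "j - 1"] j by auto
      then show ?thesis unfolding degs_in_def by fastforce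
    qed
    then show "degs_in {w + 1..} (gen_deg j) (u j - h j + q (j - 1))"
      unfolding h_def by (intro degs_in_add degs_in_minus_hom_part u j)
  next
    have "(\<Sum>j=1..n. h j * basis j) = (\<Sum>j=1..n. q (j - 1) * basis j)"
      using sum_syz_basis[of n q] q0 n hq by simp
    then show "F = (\<Sum>j=1..n. (u j - h j + q (j - 1)) * basis j)"
      unfolding F(1) by (simp add: algebra_simps sum.distrib sum_subtractf)
  qed
qed

text \<open>An arbitrary representation by the two generators is improved \<open>w\<close> times; at
  order 0 there is no condition on the coefficients. This is the standard basis property.\<close>

lemma standard_representation:
  fixes F :: "'k ps2"
  assumes "F \<in> ideal_gen {basis 1, basis 2}" "degs_in {int w..} 0 F"
  shows "\<exists>u. (\<forall>j\<in>{1..n}. degs_in {int w..} (gen_deg j) (u j)) \<and> F = (\<Sum>j=1..n. u j * basis j)"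
  using assms(2)
proof (induction w)
  case 0
  from assms(1) obtain a b where F: "F = a * basis 1 + b * basis 2"
    unfolding ideal_gen_pair by blast
  define u where "u j = (if j = 1 then a else if j = 2 then b else 0)" for j :: nat
  have "(\<Sum>j=1..n. u j * basis j) = (\<Sum>j\<in>{1, 2}. u j * basis j)"
    using n by (intro sum.mono_neutral_right) (auto simp: u_def)
  then have "F = (\<Sum>j=1..n. u j * basis j)"
    by (simp add: F u_def)
  then show ?case
    by (auto intro!: exI[of _ u] simp: degs_in_def gen_deg_def)
next
  case (Suc w)
  then have "degs_in {int w..} 0 F"
    by (rule_tac degs_in_mono) auto
  then obtain u where "\<forall>j\<in>{1..n}. degs_in {int w..} (gen_deg j) (u j)" "F = (\<Sum>j=1..n. u j * basis j)"
    using Suc.IH by blast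
  then show ?case
    using improve_representation[of "int w" u F] Suc.prems by (simp add: add.commute)
qed

section \<open>The leading ideal and its resolution\<close>

definition gr_syz :: "(nat \<Rightarrow> 'k gr) \<Rightarrow> nat \<Rightarrow> 'k gr" where
  "gr_syz W j = gr_mon (d j) 0 * W j - gr_mon 0 (s (Suc j)) * W (Suc j)"

text \<open>Entries of \<open>U\<close> outside \<open>{1..n}\<close> are ignored, so the full range
  is already the image of the free module.\<close>

definition gr_eps :: "(nat \<Rightarrow> 'k gr) \<Rightarrow> 'k gr" where
  "gr_eps U = (\<Sum>j=1..n. U j * gr_mon (p j) (t j))"

lemma gr_series_gr_syz: "gr_series (gr_syz W j) = syz (\<lambda>j. gr_series (W j)) j"
  by (simp add: gr_syz_def syz_def)

lemma gr_series_gr_eps: "gr_series (gr_eps U) = (\<Sum>j=1..n. gr_series (U j) * mon (p j) (t j))"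
  by (simp add: gr_eps_def gr_series_sum)

lemma gr_eps_add: "gr_eps (U + V) = gr_eps U + gr_eps V"
  by (simp add: gr_eps_def distrib_right sum.distrib)

lemma gr_eps_scale: "gr_eps (free_scale r U) = r * gr_eps U"
  by (simp add: gr_eps_def free_scale_def sum_distrib_left mult.assoc)

lemma range_gr_eps: "range gr_eps = ideal_gen ((\<lambda>j. gr_mon (p j) (t j)) ` {1..n})"
proof
  show "range gr_eps \<subseteq> ideal_gen ((\<lambda>j. gr_mon (p j) (t j)) ` {1..n})"
    unfolding gr_eps_def
    by (intro image_subsetI module.span_sum[OF module_mult] module.span_scale[OF module_mult]
        module.span_base[OF module_mult] imageI)
  have "gr_mon (p j) (t j) \<in> range gr_eps" if "j \<in> {1..n}" for j
  proof
    have "gr_eps (\<lambda>i. if i = j then 1 else 0) = (\<Sum>i\<in>{1..n}. if i = j then gr_mon (p i) (t i) else 0)"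
      unfolding gr_eps_def by (intro sum.cong) auto
    also have "\<dots> = gr_mon (p j) (t j)"
      using that by simp
    finally show "gr_mon (p j) (t j) = gr_eps (\<lambda>i. if i = j then 1 else 0)" ..
  qed simp
  moreover have "module.subspace (*) (range gr_eps)"
  proof (rule module.subspaceI[OF module_mult])
    show "0 \<in> range gr_eps"
      by (rule range_eqI[of _ _ "\<lambda>_. 0"]) (simp add: gr_eps_def)
  qed (auto simp flip: gr_eps_add gr_eps_scale)
  ultimately show "ideal_gen ((\<lambda>j. gr_mon (p j) (t j)) ` {1..n}) \<subseteq> range gr_eps"
    by (intro module.span_minimal[OF module_mult]) auto
qed

text \<open>In a standard representation at the order of \<open>F\<close>, the leading components of
  the coefficients express the initial form through the monomials. Being homogeneous, they are
  polynomials.\<close>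

lemma initial_form_mem:
  assumes "F \<in> ideal_gen {basis 1, basis 2}" "F \<noteq> 0"
  shows "initial_form F \<in> range gr_eps"
proof -
  define v where "v = v_n F"
  have mem: "F \<in> ideal_power \<nn> v"
    using mem_ideal_power_v_n[OF assms(2)] by (simp add: v_def)
  then obtain u where u: "\<And>j. j \<in> {1..n} \<Longrightarrow> degs_in {int v..} (gen_deg j) (u j)"
    and F: "F = (\<Sum>j=1..n. u j * basis j)"
    using standard_representation[OF assms(1), of v] unfolding ideal_power_max_ideal by blast
  define h where "h j = hom_part (int v - gen_deg j) (u j)" for j
  have h: "degs_in {int v} (gen_deg j) (h j)" for j
    unfolding h_def by (rule degs_in_hom_part)
  have "hom_part (int v) F = (\<Sum>j=1..n. h j * mon (p j) (t j))"
  proof (rule hom_part_unique)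
    show "degs_in {int v} 0 (\<Sum>j=1..n. h j * mon (p j) (t j))"
      using h by (intro degs_in_sum) (simp add: mult.commute[of "h _"] degs_in_mon_mult gen_deg_def)
    show "degs_in {int v + 1..} 0 (F - (\<Sum>j=1..n. h j * mon (p j) (t j)))"
      using leading_part[OF u] unfolding F h_def .
  qed
  moreover have "\<exists>H. gr_series H = h j" for j
    by (rule gr_series_surj[of "int v - gen_deg j"])
       (use h[of j] in \<open>fastforce simp: degs_in_def\<close>)
  then obtain H where "\<And>j. gr_series (H j) = h j" by metis
  ultimately have "gr_series (initial_form F) = gr_series (gr_eps H)"
    using mem by (simp add: initial_form_def gr_series_gr_class gr_series_gr_eps flip: v_def)
  then show ?thesis by simp
qed

lemma leading_ideal_basis: "leading_ideal (ideal_gen {basis 1, basis 2}) = range gr_eps"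
proof
  show "leading_ideal (ideal_gen {basis 1, basis 2}) \<subseteq> range gr_eps"
    unfolding leading_ideal_def
  proof (rule module.span_minimal[OF module_mult])
    show "module.subspace (*) (range gr_eps)"
      unfolding range_gr_eps by (rule module.subspace_span[OF module_mult])
  qed (auto intro: initial_form_mem)
  have "gr_mon (p j) (t j) \<in> leading_ideal (ideal_gen {basis 1, basis 2})" if "j \<in> {1..n}" for j
  proof -
    have "basis j \<noteq> 0" using cf_basis[of j] that by auto
    then show ?thesis
      unfolding leading_ideal_def
      using initial_form_basis[of j] basis_mem_ideal[of j] that
      by (intro module.span_base[OF module_mult]) force
  qed
  then show "range gr_eps \<subseteq> leading_ideal (ideal_gen {basis 1, basis 2})"
    unfolding range_gr_eps
    by (intro module.span_minimal[OF module_mult])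
       (auto simp: leading_ideal_def module.subspace_span[OF module_mult])
qed

section \<open>Exactness and minimality of the resolution\<close>

lemma gr_eps_gr_syz:
  assumes "W \<in> free_module {2..n}"
  shows "gr_eps (gr_syz W) = 0"
proof (rule gr_series_inject)
  have "W 1 = 0" "W (Suc n) = 0" using assms by (auto simp: free_module_def)
  then show "gr_series (gr_eps (gr_syz W)) = gr_series 0"
    unfolding gr_series_gr_eps gr_series_gr_syz
    using sum_syz_mon[of n "\<lambda>j. gr_series (W j)"] n by simp
qed

lemma gr_syz_free_module: "W \<in> free_module {2..n} \<Longrightarrow> gr_syz W \<in> free_module {1..n}"
  by (auto simp: free_module_def gr_syz_def)

text \<open>\<open>syzygy_exists\<close> only yields power series as coefficients. A degree bound on
  \<open>U\<close> passes to them by \<open>syzygy_degs_in\<close>, so they come from the graded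
  ring.\<close>

lemma gr_syzygy_exists:
  assumes U: "U \<in> free_module {1..n}" and "gr_eps U = 0"
  shows "\<exists>W\<in>free_module {2..n}. gr_syz W = U"
proof -
  let ?u = "\<lambda>j. gr_series (U j)"
  have "(\<Sum>j=1..n. ?u j * mon (p j) (t j)) = 0"
    using assms(2) gr_series_gr_eps[of U] by simp
  then obtain w where w0: "\<And>j. j \<notin> {2..n} \<Longrightarrow> w j = 0" and uw: "\<And>j. j \<in> {1..n} \<Longrightarrow> ?u j = syz w j"
    using syzygy_exists[of n ?u] one_le_n by blast
  have "\<forall>j. \<exists>N. degs_in {..N} 0 (?u j)"
    using gr_series_bounded by blast
  then obtain N where N: "\<And>j. degs_in {..N j} 0 (?u j)"
    unfolding choice_iff by blast
  \<comment> \<open>A common bound for the degrees of all products of \<open>U j\<close> with its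
    monomial.\<close>
  define M where "M = Max ((\<lambda>j. N j + gen_deg j) ` {1..n})"
  have u: "degs_in {..M} (gen_deg j) (?u j)" if "j \<in> {1..n}" for j
  proof -
    have "N j + gen_deg j \<le> M"
      unfolding M_def using that by (intro Max_ge) auto
    then show ?thesis
      using N[of j] by (fastforce simp: degs_in_def)
  qed
  have "\<exists>W. gr_series W = w j" for j
  proof (cases "j \<in> {2..n}")
    case True
    then have "degs_in {..M} (syz_deg j) (w j)"
      by (intro syzygy_degs_in[OF w0 uw u]) auto
    then show ?thesis
      by (intro gr_series_surj[of "M - syz_deg j"]) (fastforce simp: degs_in_def)
  next
    case False
    then show ?thesis using w0 gr_series_zero by metis
  qed
  then obtain W where W: "\<And>j. gr_series (W j) = w j" by metis
  have "W j = 0" if "j \<notin> {2..n}" for j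
    using W[of j] w0[OF that] by (simp flip: gr_series_eq_iff)
  then have Wf: "W \<in> free_module {2..n}"
    by (simp add: free_module_def)
  moreover have "gr_syz W j = U j" for j
  proof (cases "j \<in> {1..n}")
    case True
    then show ?thesis
      by (intro gr_series_inject) (simp add: gr_series_gr_syz W uw)
  next
    case False
    then show ?thesis
      using U gr_syz_free_module[OF Wf] unfolding free_module_def by auto
  qed
  ultimately show ?thesis by blast
qed

lemma inj_on_gr_syz: "inj_on gr_syz (free_module {2..n})"
proof (rule inj_onI, rule ext)
  fix V W j assume V: "V \<in> free_module {2..n}" and W: "W \<in> free_module {2..n}"
    and eq: "gr_syz V = gr_syz W"
  show "V j = W j"
  proof (cases "j \<in> {2..n}")
    case True
    let ?w = "\<lambda>j. gr_series (V j) - gr_series (W j)"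
    have "syz ?w j = gr_series (gr_syz V j) - gr_series (gr_syz W j)" for j
      by (simp add: gr_series_gr_syz syz_def algebra_simps)
    then have "syz ?w j = 0" for j
      by (simp add: eq)
    moreover have "?w j = 0" if "j \<notin> {2..n}" for j
      using V W that by (simp add: free_module_def)
    \<comment> \<open>With empty \<open>Z\<close> this says that no monomial occurs in
      \<open>?w j\<close>.\<close>
    ultimately have "degs_in {} (syz_deg j) (?w j)"
      using True by (intro syzygy_degs_in[of ?w "\<lambda>_. 0"]) auto
    then have "?w j = 0"
      using degs_in_disjoint by blast
    then show ?thesis by simp
  next
    case False
    then show ?thesis using V W by (simp add: free_module_def)
  qed
qed

text \<open>Relation \<open>i\<close> has the entries \<open>x^(d i)\<close> in place
  \<open>i\<close> and \<open>- y^(s i)\<close> in place \<open>i - 1\<close>, both of positive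
  degree.\<close>

lemma gr_syz_minimal:
  assumes "W \<in> free_module {2..n}"
  shows "gr_syz W \<in>
    module.span free_scale {free_scale r u | r u. r \<in> irrelevant_ideal \<and> u \<in> free_module {1..n}}"
    (is "_ \<in> module.span _ ?S")
proof -
  define E where "E i r = (\<lambda>j. if j = i then r else 0)" for i :: nat and r :: "'k gr"
  have E: "free_scale r (E i x) \<in> module.span free_scale ?S"
    if "i \<in> {1..n}" "r \<in> irrelevant_ideal" for i r x
  proof (rule module.span_base[OF module_free_scale])
    have "E i x \<in> free_module {1..n}" using that by (auto simp: E_def free_module_def)
    then show "free_scale r (E i x) \<in> ?S" using that by blast
  qed
  have "gr_syz W = (\<Sum>i=2..n. free_scale (gr_mon (d i) 0) (E i (W i)) -
      free_scale (gr_mon 0 (s i)) (E (i - 1) (W i)))" (is "_ = ?R")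
  proof
    fix j
    have sum_app: "(\<Sum>i\<in>A. f i) j = (\<Sum>i\<in>A. f i j)" for A and f :: "nat \<Rightarrow> nat \<Rightarrow> 'k gr"
      by (induction A rule: infinite_finite_induct) auto
    have "?R j = (\<Sum>i=2..n. if i = j then gr_mon (d j) 0 * W j else 0) -
        (\<Sum>i=2..n. if i = Suc j then gr_mon 0 (s (Suc j)) * W (Suc j) else 0)"
      unfolding sum_app sum_subtractf[symmetric]
      by (intro sum.cong) (auto simp: free_scale_def E_def)
    also have "\<dots> = gr_syz W j"
      using assms by (auto simp: gr_syz_def free_module_def)
    finally show "gr_syz W j = ?R j" ..
  qed
  moreover have "?R \<in> module.span free_scale ?S"
    using d_pos s_pos
    by (intro module.span_sum[OF module_free_scale] module.span_diff[OF module_free_scale] E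
        gr_mon_irrelevant) auto
  ultimately show ?thesis by simp
qed

lemma minimal_resolution:
  assumes c: "\<And>j. j \<in> {1..n} \<Longrightarrow> c j = gen_deg j"
    and e: "\<And>j. j \<in> {2..n} \<Longrightarrow> e j = syz_deg j"
  shows "minimal_graded_free_resolution {2..n} e {1..n} c (range gr_eps) gr_syz gr_eps"
  unfolding minimal_graded_free_resolution_def
proof (intro conjI allI)
  show "linear_on (free_module {2..n}) free_scale free_scale gr_syz"
    by (auto simp: linear_on_def gr_syz_def free_scale_def fun_eq_iff algebra_simps)
  show "linear_on (free_module {1..n}) free_scale (*) gr_eps"
    by (simp add: linear_on_def gr_eps_add gr_eps_scale)
  show "gr_syz ` free_piece {2..n} e m \<subseteq> free_piece {1..n} c m" for m
  proof
    fix U assume "U \<in> gr_syz ` free_piece {2..n} e m"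
    then obtain W where U: "U = gr_syz W" and W: "W \<in> free_module {2..n}"
      and deg: "\<And>j. j \<in> {2..n} \<Longrightarrow> degs_in {m} (syz_deg j) (gr_series (W j))"
      by (auto simp: free_piece_def mem_gr_piece_iff degs_in_single_shift e)
    have "degs_in {m} (gen_deg j) (gr_series (U j))" if j: "j \<in> {1..n}" for j
    proof -
      have "degs_in {m} (gen_deg j) (mon (d j) 0 * gr_series (W j))"
      proof (cases "j = 1")
        case True
        then show ?thesis using W by (simp add: free_module_def)
      next
        case False
        then show ?thesis
          using deg[of j] j by (simp add: degs_in_mon_mult gen_deg_def syz_deg_def)
      qed
      moreover have "degs_in {m} (gen_deg j) (mon 0 (s (Suc j)) * gr_series (W (Suc j)))"
      proof (cases "j = n")
        case True
        then show ?thesis using W by (simp add: free_module_def)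
      next
        case False
        then show ?thesis
          using deg[of "Suc j"] j syz_deg_Suc[of j] by (simp add: degs_in_mon_mult)
      qed
      ultimately show ?thesis
        unfolding U gr_series_gr_syz syz_def by (rule degs_in_diff)
    qed
    then show "U \<in> free_piece {1..n} c m"
      using gr_syz_free_module[OF W]
      by (simp add: free_piece_def mem_gr_piece_iff degs_in_single_shift c U)
  qed
  show "gr_eps ` free_piece {1..n} c m \<subseteq> gr_piece m" for m
  proof
    fix F assume "F \<in> gr_eps ` free_piece {1..n} c m"
    then obtain U where F: "F = gr_eps U"
      and deg: "\<And>j. j \<in> {1..n} \<Longrightarrow> degs_in {m} (gen_deg j) (gr_series (U j))"
      by (auto simp: free_piece_def mem_gr_piece_iff degs_in_single_shift c)
    show "F \<in> gr_piece m"
      unfolding F mem_gr_piece_iff gr_series_gr_eps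
      using deg by (intro degs_in_sum)
        (simp add: mult.commute[of "gr_series _"] degs_in_mon_mult gen_deg_def)
  qed
  show "gr_syz ` free_module {2..n} = {u \<in> free_module {1..n}. gr_eps u = 0}"
    using gr_eps_gr_syz gr_syz_free_module gr_syzygy_exists by blast
  show "gr_eps ` free_module {1..n} = range gr_eps"
  proof -
    have "gr_eps U = gr_eps (\<lambda>j. if j \<in> {1..n} then U j else 0)" for U
      unfolding gr_eps_def by (intro sum.cong) auto
    moreover have "(\<lambda>j. if j \<in> {1..n} then U j else 0) \<in> free_module {1..n}" for U
      by (simp add: free_module_def)
    ultimately show ?thesis by blast
  qed
  show "gr_syz ` free_module {2..n} \<subseteq>
      module.span free_scale {free_scale r u | r u. r \<in> irrelevant_ideal \<and> u \<in> free_module {1..n}}"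
    using gr_syz_minimal by blast
qed (simp_all add: inj_on_gr_syz)

section \<open>The minimal number of generators\<close>

lemma staircase_strict:
  assumes "1 \<le> i" "i < j" "j \<le> n"
  shows "p j < p i \<and> t i < t j"
  using Suc_leI[OF assms(2)] assms(3)
proof (induction j rule: dec_induct)
  case base
  then show ?case
    using p_step[of i] t_step[of i] d_pos[of "Suc i"] s_pos[of "Suc i"] assms(1) by simp
next
  case (step j)
  then show ?case
    using p_step[of j] t_step[of j] assms(1) by simp
qed

text \<open>Along the staircase \<open>p\<close> falls and \<open>t\<close> rises strictly, so no
  corner monomial divides another.\<close>

lemma staircase_eq:
  assumes "i \<in> {1..n}" "j \<in> {1..n}" "p i \<le> p j" "t i \<le> t j"
  shows "i = j"
  using staircase_strict[of i j] staircase_strict[of j i] assms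
  by (cases i j rule: linorder_cases) auto

lemma cf_gr_eps_nonzero:
  assumes "cf (gr_series (gr_eps U)) i k \<noteq> 0"
  shows "\<exists>j\<in>{1..n}. p j \<le> i \<and> t j \<le> k"
proof -
  have "(\<Sum>j=1..n. cf (mon (p j) (t j) * gr_series (U j)) i k) \<noteq> 0"
    using assms by (simp add: gr_series_gr_eps cf_sum mult.commute)
  then obtain j where "j \<in> {1..n}" "cf (mon (p j) (t j) * gr_series (U j)) i k \<noteq> 0"
    by (meson sum.neutral)
  then show ?thesis
    by (auto simp: cf_mon_mult split: if_splits)
qed

text \<open>
  No proper divisor of a corner monomial occurs in an element of the leading ideal. Hence on that ideal
  \<open>corners\<close> factors through \<open>I\<^sup>* / \<mm>I\<^sup>*\<close>, where \<open>\<mm>\<close> is the irrelevant ideal.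
\<close>

definition corners :: "'k gr \<Rightarrow> nat \<Rightarrow> 'k" where
  "corners F j = (if j \<in> {1..n} then cf (gr_series F) (p j) (t j) else 0)"

text \<open>Every other term of the convolution contains a coefficient of \<open>F\<close> at a
  proper divisor of the corner, which is zero.\<close>

lemma corners_mult:
  assumes "F \<in> range gr_eps"
  shows "corners (r * F) j = cf (gr_series r) 0 0 * corners F j"
proof (cases "j \<in> {1..n}")
  case True
  let ?f = "gr_series F" and ?r = "gr_series r"
  have 0: "cf ?f (p j - k) (t j - l) = 0" if "k \<le> p j" "l \<le> t j" "k \<noteq> 0 \<or> l \<noteq> 0" for k l
  proof (rule ccontr)
    assume "cf ?f (p j - k) (t j - l) \<noteq> 0"
    then obtain i where i: "i \<in> {1..n}" "p i \<le> p j - k" "t i \<le> t j - l"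
      using assms cf_gr_eps_nonzero by blast
    then have "i = j"
      using True by (intro staircase_eq) auto
    then show False using i that by auto
  qed
  have "cf (?r * ?f) (p j) (t j) =
      (\<Sum>l\<le>t j. \<Sum>k\<le>p j. if l = 0 then (if k = 0 then cf ?r 0 0 * cf ?f (p j) (t j) else 0) else 0)"
    unfolding cf_mult by (intro sum.cong refl) (auto simp: 0 0[where k = 0, simplified] 0[where l = 0, simplified])
  also have "\<dots> = (\<Sum>l\<le>t j. if l = 0 then cf ?r 0 0 * cf ?f (p j) (t j) else 0)"
    by (intro sum.cong) auto
  also have "\<dots> = cf ?r 0 0 * cf ?f (p j) (t j)"
    by simp
  finally show ?thesis
    using True by (simp add: corners_def)
qed (auto simp: corners_def)

lemma corners_gr_mon:
  assumes "i \<in> {1..n}"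
  shows "corners (gr_mon (p i) (t i)) = (\<lambda>j. if j = i then 1 else 0)"
  using staircase_eq[OF _ assms] assms by (auto simp: corners_def cf_mon fun_eq_iff)

text \<open>Under \<open>corners\<close> the monomials become \<open>n\<close> independent unit
  vectors, and these lie in the span over \<open>k\<close> of the images of the generators.\<close>

lemma card_generators_ge:
  assumes "finite G" and G: "ideal_gen G = range gr_eps"
  shows "n \<le> card G"
proof -
  define scale where "scale a v = (\<lambda>j. a * v j)" for a :: 'k and v :: "nat \<Rightarrow> 'k"
  interpret V: vector_space scale
    by standard (auto simp: scale_def fun_eq_iff algebra_simps)
  define unit where "unit i = (\<lambda>j. if j = i then 1 else 0 :: 'k)" for i :: nat
  have span: "corners F \<in> V.span (corners ` G)" if "F \<in> ideal_gen G" for F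
    using that
  proof (induction F rule: module.span_induct_alt[OF module_mult, consumes 1])
    case 1
    have "corners 0 = 0" by (simp add: corners_def fun_eq_iff)
    then show ?case using V.span_zero by (simp only:)
  next
    case (2 r z F)
    have "z \<in> range gr_eps"
      using 2 G module.span_base[OF module_mult] by blast
    then have eq: "corners (r * z + F) = scale (cf (gr_series r) 0 0) (corners z) + corners F"
      by (auto simp: fun_eq_iff scale_def simp flip: corners_mult) (simp add: corners_def)
    show ?case
      unfolding eq using 2 by (intro V.span_add V.span_scale) (auto intro: V.span_base)
  qed
  have "unit ` {1..n} \<subseteq> V.span (corners ` G)"
  proof safe
    fix i assume i: "i \<in> {1..n}"
    then have "gr_mon (p i) (t i) \<in> ideal_gen G"
      unfolding G range_gr_eps by (intro module.span_base[OF module_mult] imageI)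
    then show "unit i \<in> V.span (corners ` G)"
      using span corners_gr_mon[OF i] by (fastforce simp: unit_def)
  qed
  moreover have inj: "inj_on unit {1..n}"
    unfolding unit_def by (rule inj_onI) (metis zero_neq_one)
  have "\<not> V.dependent (unit ` {1..n})"
  proof
    assume "V.dependent (unit ` {1..n})"
    then obtain a where a: "\<exists>v\<in>unit ` {1..n}. a v \<noteq> 0" "(\<Sum>v\<in>unit ` {1..n}. scale (a v) v) = 0"
      unfolding V.dependent_finite[OF finite_imageI[OF finite_atLeastAtMost]] by blast
    have sum_app: "(\<Sum>i\<in>A. f i) j = (\<Sum>i\<in>A. f i j)" for A and f :: "nat \<Rightarrow> nat \<Rightarrow> 'k" and j
      by (induction A rule: infinite_finite_induct) auto
    have "a (unit j) = 0" if "j \<in> {1..n}" for j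
    proof -
      have "0 = (\<Sum>i\<in>{1..n}. scale (a (unit i)) (unit i)) j"
        using a(2) unfolding sum.reindex[OF inj] by simp
      also have "\<dots> = (\<Sum>i\<in>{1..n}. if i = j then a (unit j) else 0)"
        unfolding sum_app by (intro sum.cong) (auto simp: scale_def unit_def)
      also have "\<dots> = a (unit j)"
        using that by simp
      finally show ?thesis ..
    qed
    then show False using a(1) by blast
  qed
  ultimately have "card (unit ` {1..n}) \<le> card (corners ` G)"
    using V.independent_span_bound[of "corners ` G"] assms(1) by blast
  also have "\<dots> \<le> card G"
    using assms(1) by (rule card_image_le)
  finally show ?thesis
    using card_image[OF inj] by simp
qed

lemma min_num_gens_leading: "min_num_gens (range gr_eps) = n"
  unfolding min_num_gens_def
proof (rule Least_equality)
  have "inj_on (\<lambda>j. gr_mon (p j) (t j) :: 'k gr) {1..n}"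
  proof (rule inj_onI)
    fix i j assume ij: "i \<in> {1..n}" "j \<in> {1..n}" and "gr_mon (p i) (t i) = (gr_mon (p j) (t j) :: 'k gr)"
    then have "cf (mon (p i) (t i)) (p i) (t i) = (cf (mon (p j) (t j)) (p i) (t i) :: 'k)"
      by (metis gr_series_gr_mon)
    then show "i = j"
      using ij by (intro staircase_eq) (auto simp: cf_mon split: if_splits)
  qed
  then show "\<exists>G. finite G \<and> card G = n \<and> ideal_gen G = range gr_eps"
    by (intro exI[of _ "(\<lambda>j. gr_mon (p j) (t j)) ` {1..n}"]) (simp add: range_gr_eps card_image)
qed (use card_generators_ge in blast)

end

section \<open>From the numerical data to a staircase\<close>

theorem theorem2p4:
  fixes a b n :: nat and c e :: "nat \<Rightarrow> int"
  assumes "1 \<le> a" and "1 \<le> b" and "a \<le> b"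
    and "2 \<le> n" and "n \<le> a + 1"
    and "c 1 = int a" and "c 2 = int b"
    and "\<forall>i\<in>{2..n-1}. c i + 2 \<le> c (i + 1)"
    and "e 1 = 0"
    and "\<forall>i\<in>{2..n-1}. c i + 1 \<le> e i \<and> e i < c (i + 1)"
    and "c n + 1 \<le> e n"
    and "(\<Sum>i=2..n. e i - c i) = int a"
  shows "\<exists>f g :: 'k::field ps2.
           regular_sequence [f, g] \<and> v_n f = a \<and> v_n g = b \<and>
           min_num_gens (leading_ideal (ideal_gen {f, g})) = n \<and>
           (\<exists>\<phi> \<epsilon>. minimal_graded_free_resolution {2..n} e {1..n} c
                     (leading_ideal (ideal_gen {f, g})) \<phi> \<epsilon>)"
proof -
  define d where "d j = nat (e j - c j)" for j
  define p where "p j = (\<Sum>i=Suc j..n. d i)" for j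
  \<comment> \<open>Chosen as the increment of \<open>c j - p j\<close>; the truncation by
    \<open>nat\<close> is harmless because \<open>c\<close> is monotone.\<close>
  define s where "s j = nat (c j - c (j - 1)) + d j" for j
  define t where "t j = (\<Sum>i=2..j. s i)" for j
  have d: "0 < d j" "int (d j) = e j - c j" if "2 \<le> j" "j \<le> n" for j
    using that assms(10,11) by (cases "j = n"; force simp: d_def)+
  have e_less: "e j < c (Suc j)" if "2 \<le> j" "j < n" for j
    using that assms(10) by auto
  have c_mono: "c j \<le> c (Suc j)" if "1 \<le> j" "j < n" for j
  proof (cases "j = 1")
    case True
    then show ?thesis using assms(3,6,7) by (simp add: numeral_2_eq_2)
  next
    case False
    then show ?thesis using e_less[of j] d[of j] that by auto
  qed
  have s: "int (s (Suc j)) = c (Suc j) - c j + int (d (Suc j))" if "1 \<le> j" "j < n" for j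
    using c_mono[OF that] by (simp add: s_def)
  have p_step: "p j = d (Suc j) + p (Suc j)" if "j < n" for j
    unfolding p_def using that by (simp add: sum.atLeast_Suc_atMost)
  have t_step: "t (Suc j) = t j + s (Suc j)" if "1 \<le> j" for j
    unfolding t_def using that by simp
  have "int (p 1) = (\<Sum>i=2..n. e i - c i)"
    unfolding p_def of_nat_sum by (intro sum.cong) (auto simp: d(2))
  then have p1: "p 1 = a"
    using assms(12) by simp
  have t1: "t 1 = 0" by (simp add: t_def)
  have c_eq: "c j = int (p j + t j)" if "1 \<le> j" "j \<le> n" for j
    using that
  proof (induction j rule: dec_induct)
    case base
    then show ?case using p1 t1 assms(6) by simp
  next
    case (step j)
    then show ?case using p_step[of j] t_step[of j] s[of j] by simp
  qed
  interpret staircase n p t d s "TYPE('k)"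
  proof
    \<comment> \<open>The difference of the two sides is
      \<open>c (j + 2) - c (j + 1) - d (j + 1) = c (j + 2) - e (j + 1)\<close>.\<close>
    show "p j < s (Suc (Suc j)) + p (Suc (Suc j))" if "1 \<le> j" "Suc (Suc j) \<le> n" for j
      using that p_step[of j] p_step[of "Suc j"] s[of "Suc j"] d(2)[of "Suc j"] e_less[of "Suc j"] by simp
    show "0 < s j" if "2 \<le> j" "j \<le> n" for j
      using d(1)[OF that] by (simp add: s_def)
  qed (use assms(4) p_step t_step d(1) t1 in \<open>auto simp: p_def\<close>)
  have "minimal_graded_free_resolution {2..n} e {1..n} c (range gr_eps) gr_syz gr_eps"
    by (rule minimal_resolution) (use c_eq d(2) in \<open>auto simp: gen_deg_def syz_deg_def\<close>)
  moreover have "v_n (basis 1) = a" "v_n (basis 2) = b"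
    using v_n_basis[of 1] v_n_basis[of 2] assms(4,7) c_eq[of 2] p1 t1 by auto
  moreover have "regular_sequence [basis 1, basis 2 :: 'k ps2]"
    using p1 assms(1) by (intro regular_sequence_basis) simp
  ultimately show ?thesis
    using min_num_gens_leading unfolding leading_ideal_basis[symmetric] by blast
qed

end
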